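(* Let $R$ be an associative ring with unit and let $(\mathcal M,\mathcal C)$ be a duality pair over $R$. Then $(\mathrm{dw}\widetilde{\mathcal M},\mathrm{dw}\widetilde{\mathcal C})$, $(\mathrm{ex}\widetilde{\mathcal M},\mathrm{ex}\widetilde{\mathcal C})$ and $(\widetilde{\mathcal M},\widetilde{\mathcal C})$ are dual pairs over $R$. Moreover: - If $(\mathcal M,\mathcal C)$ is product-closed (resp. coproduct-closed), then so are $(\mathrm{dw}\widetilde{\mathcal M},\mathrm{dw}\widetilde{\mathcal C})$, $(\mathrm{ex}\widetilde{\mathcal M},\mathrm{ex}\widetilde{\mathcal C})$ and $(\widetilde{\mathcal M},\widetilde{\mathcal C})$. - If $(\mathcal M,\mathcal C)$ is perfect, then so are $(\mathrm{dw}\widetilde{\mathcal M},\mathrm{dw}\widetilde{\mathcal C})$, $(\mathrm{ex}\widetilde{\mathcal M},\mathrm{ex}\widetilde{\mathcal C})$ and $(\widetilde{\mathcal M},\widetilde{\mathcal C})$. Conversely, let $\mathcal M$ be a class of left $R$-modules and $\mathcal C$ a class of right $R$-modules. If $(\mathrm{dw}\widetilde{\mathcal M},\mathrm{dw}\widetilde{\mathcal C})$, $(\mathrm{ex}\widetilde{\mathcal M},\mathrm{ex}\widetilde{\mathcal C})$ or $(\widetilde{\mathcal M},\widetilde{\mathcal C})$ is a dual pair over $R$, then $(\mathcal M,\mathcal C)$ is a duality pair over $R$. Moreover, if any of these pairs is product-closed, coproduct-closed or perfect, then so is $(\mathcal M,\mathcal C)$, respectively.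
   Context: Write $M^+=\mathrm{Hom}_{\mathbb Z}(M,\mathbb Q/\mathbb Z)$ for a module $M$. A duality pair over $R$ is a pair $(\mathcal M,\mathcal C)$ with $\mathcal M$ a class of left (resp. right) $R$-modules and $\mathcal C$ a class of right (resp. left) $R$-modules such that: for every left (resp. right) module $M$, $M\in\mathcal M$ if and only if $M^+\in\mathcal C$; and $\mathcal C$ is closed under direct summands and finite direct sums. It is product-closed (coproduct-closed) if $\mathcal M$ is closed under arbitrary products (coproducts), and perfect if it is coproduct-closed, $\mathcal M$ is closed under extensions, and $R\in\mathcal M$. For a complex $X$ of left (right) modules, its Pontrjagin dual $X^+$ is the complex of right (left) modules (up to isomorphism and degree indexing, immaterial here) $\cdots\to\mathrm{Hom}_{\mathbb Z}(X_{-n-2},\mathbb Q/\mathbb Z)\xrightarrow{\delta_n}\mathrm{Hom}_{\mathbb Z}(X_{-n-1},\mathbb Q/\mathbb Z)\to\cdots$, $\delta_n=(-1)^n\mathrm{Hom}_{\mathbb Z}(\delta^X_{-n-1},\mathbb Q/\mathbb Z)$. A dual pair over $R$ is a pair $(\mathscr M,\mathscr C)$ with $\mathscr M$ a class of complexes of left (resp. right) modules and $\mathscr C$ a class of complexes of right (resp. left) modules such that: for every complex $X$ of left (resp. right) modules, $X\in\mathscr M$ if and only if $X^+\in\mathscr C$; and $\mathscr C$ is closed under direct summands and finite direct sums. It is product-closed (coproduct-closed) if $\mathscr M$ is closed under products (coproducts), and perfect if it is coproduct-closed, $\mathscr M$ is closed under extensions, and $D^0(R)\in\mathscr M$, where $D^0(R)$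 is the complex $\cdots\to 0\to R\xrightarrow{\mathrm{id}}R\to 0\to\cdots$ with $R$ in degrees $0$ and $-1$. For a class $\mathcal M$ of modules: $\mathrm{dw}\widetilde{\mathcal M}$ is the class of complexes $X$ with $X_m\in\mathcal M$ for all $m\in\mathbb Z$; $\mathrm{ex}\widetilde{\mathcal M}$ is the class of exact complexes in $\mathrm{dw}\widetilde{\mathcal M}$; $\widetilde{\mathcal M}$ is the class of exact complexes $X$ with all cycle modules $Z_m(X)\in\mathcal M$. *)

theory Defs
  imports Complex_Main "HOL-Algebra.Module"
begin

section \<open>The group of rationals modulo the integers\<close>

definition qz_rel :: "rat \<Rightarrow> rat \<Rightarrow> bool"
  where "qz_rel x y \<longleftrightarrow> x - y \<in> \<int>"

lemma equivp_qz_rel: "equivp qz_rel"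
proof (rule equivpI)
  show "reflp qz_rel" by (simp add: reflp_def qz_rel_def)
  show "symp qz_rel" unfolding symp_def qz_rel_def
    by (metis Ints_minus minus_diff_eq)
  show "transp qz_rel" unfolding transp_def qz_rel_def
    by (metis Ints_add diff_add_cancel add_diff_eq)
qed

quotient_type qz = rat / qz_rel
  by (rule equivp_qz_rel)

instantiation qz :: ab_group_add
begin

lift_definition zero_qz :: qz is "0 :: rat" .

lift_definition plus_qz :: "qz \<Rightarrow> qz \<Rightarrow> qz" is "(+)"
proof -
  fix a b c d :: rat
  assume "qz_rel a b" "qz_rel c d"
  then have "(a - b) + (c - d) \<in> \<int>" unfolding qz_rel_def by (rule Ints_add)
  then show "qz_rel (a + c) (b + d)" unfolding qz_rel_def by (simp add: algebra_simps)
qed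

lift_definition uminus_qz :: "qz \<Rightarrow> qz" is "uminus"
proof -
  fix a b :: rat
  assume "qz_rel a b"
  then have "- (a - b) \<in> \<int>" unfolding qz_rel_def by (rule Ints_minus)
  then show "qz_rel (- a) (- b)" unfolding qz_rel_def by (simp add: algebra_simps)
qed

lift_definition minus_qz :: "qz \<Rightarrow> qz \<Rightarrow> qz" is "(-)"
proof -
  fix a b c d :: rat
  assume "qz_rel a b" "qz_rel c d"
  then have "(a - b) - (c - d) \<in> \<int>" unfolding qz_rel_def by (rule Ints_diff)
  then show "qz_rel (a - c) (b - d)" unfolding qz_rel_def by (simp add: algebra_simps)
qed

instance
  by standard (transfer; simp add: qz_rel_def algebra_simps)+

end


section \<open>Left and right modules\<close>

datatype side = LeftSide | RightSide

fun opposite :: "side \<Rightarrow> side" where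
  "opposite LeftSide = RightSide"
| "opposite RightSide = LeftSide"

text \<open>
  The locale \<^locale>\<open>module\<close> demands a commutative ring, so only its record type is reused here.
  The fields \<^const>\<open>mult\<close> and \<^const>\<open>one\<close> of that record carry no meaning for modules and are
  ignored throughout. For a right module, \<open>a \<odot>\<^bsub>M\<^esub> x\<close> stands for the product of \<open>x\<close> by \<open>a\<close> from
  the right; hence the reversed associativity law.
\<close>

definition is_module ::
  "side \<Rightarrow> ('r, 'k) ring_scheme \<Rightarrow> ('r, 'm) module \<Rightarrow> bool" where
  "is_module s R M \<longleftrightarrow>
     abelian_group M \<and>
     (\<forall>a\<in>carrier R. \<forall>x\<in>carrier M. a \<odot>\<^bsub>M\<^esub> x \<in> carrier M) \<and>
     (\<forall>a\<in>carrier R. \<forall>b\<in>carrier R. \<forall>x\<in>carrier M.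
        (a \<oplus>\<^bsub>R\<^esub> b) \<odot>\<^bsub>M\<^esub> x = (a \<odot>\<^bsub>M\<^esub> x) \<oplus>\<^bsub>M\<^esub> (b \<odot>\<^bsub>M\<^esub> x)) \<and>
     (\<forall>a\<in>carrier R. \<forall>x\<in>carrier M. \<forall>y\<in>carrier M.
        a \<odot>\<^bsub>M\<^esub> (x \<oplus>\<^bsub>M\<^esub> y) = (a \<odot>\<^bsub>M\<^esub> x) \<oplus>\<^bsub>M\<^esub> (a \<odot>\<^bsub>M\<^esub> y)) \<and>
     (\<forall>a\<in>carrier R. \<forall>b\<in>carrier R. \<forall>x\<in>carrier M.
        (case s of
           LeftSide \<Rightarrow> (a \<otimes>\<^bsub>R\<^esub> b) \<odot>\<^bsub>M\<^esub> x = a \<odot>\<^bsub>M\<^esub> (b \<odot>\<^bsub>M\<^esub> x)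
         | RightSide \<Rightarrow> (a \<otimes>\<^bsub>R\<^esub> b) \<odot>\<^bsub>M\<^esub> x = b \<odot>\<^bsub>M\<^esub> (a \<odot>\<^bsub>M\<^esub> x))) \<and>
     (\<forall>x\<in>carrier M. \<one>\<^bsub>R\<^esub> \<odot>\<^bsub>M\<^esub> x = x)"

definition regular_module :: "side \<Rightarrow> ('r, 'k) ring_scheme \<Rightarrow> ('r, 'r) module" where
  "regular_module s R =
     \<lparr>carrier = carrier R, mult = undefined, one = undefined,
      zero = \<zero>\<^bsub>R\<^esub>, add = (\<oplus>\<^bsub>R\<^esub>),
      smult = (case s of LeftSide \<Rightarrow> (\<lambda>a x. a \<otimes>\<^bsub>R\<^esub> x) | RightSide \<Rightarrow> (\<lambda>a x. x \<otimes>\<^bsub>R\<^esub> a))\<rparr>"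

definition mod_hom ::
  "('r, 'k) ring_scheme \<Rightarrow> ('r, 'm) module \<Rightarrow> ('r, 'n) module \<Rightarrow> ('m \<Rightarrow> 'n) set" where
  "mod_hom R M N =
     {f \<in> carrier M \<rightarrow> carrier N.
        (\<forall>x\<in>carrier M. \<forall>y\<in>carrier M. f (x \<oplus>\<^bsub>M\<^esub> y) = f x \<oplus>\<^bsub>N\<^esub> f y) \<and>
        (\<forall>a\<in>carrier R. \<forall>x\<in>carrier M. f (a \<odot>\<^bsub>M\<^esub> x) = a \<odot>\<^bsub>N\<^esub> f x)}"

definition mod_isomorphic ::
  "('r, 'k) ring_scheme \<Rightarrow> ('r, 'm) module \<Rightarrow> ('r, 'n) module \<Rightarrow> bool" where
  "mod_isomorphic R M N \<longleftrightarrow>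
     (\<exists>f\<in>mod_hom R M N. bij_betw f (carrier M) (carrier N))"

definition submodule_on :: "('r, 'm) module \<Rightarrow> 'm set \<Rightarrow> ('r, 'm) module" where
  "submodule_on M A = M\<lparr>carrier := A\<rparr>"

definition mod_short_exact ::
  "('r, 'k) ring_scheme \<Rightarrow> ('r, 'l) module \<Rightarrow> ('l \<Rightarrow> 'm) \<Rightarrow> ('r, 'm) module \<Rightarrow>
   ('m \<Rightarrow> 'n) \<Rightarrow> ('r, 'n) module \<Rightarrow> bool" where
  "mod_short_exact R L f M g N \<longleftrightarrow>
     f \<in> mod_hom R L M \<and> g \<in> mod_hom R M N \<and>
     inj_on f (carrier L) \<and>
     f ` carrier L = {x \<in> carrier M. g x = \<zero>\<^bsub>N\<^esub>} \<and>
     g ` carrier M = carrier N"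

definition mod_product ::
  "'i set \<Rightarrow> ('i \<Rightarrow> ('r, 'm) module) \<Rightarrow> ('r, 'i \<Rightarrow> 'm) module" where
  "mod_product I M =
     \<lparr>carrier = (\<Pi>\<^sub>E i\<in>I. carrier (M i)), mult = undefined, one = undefined,
      zero = (\<lambda>i\<in>I. \<zero>\<^bsub>M i\<^esub>),
      add = (\<lambda>x y. \<lambda>i\<in>I. x i \<oplus>\<^bsub>M i\<^esub> y i),
      smult = (\<lambda>a x. \<lambda>i\<in>I. a \<odot>\<^bsub>M i\<^esub> x i)\<rparr>"

definition mod_coproduct ::
  "'i set \<Rightarrow> ('i \<Rightarrow> ('r, 'm) module) \<Rightarrow> ('r, 'i \<Rightarrow> 'm) module" where
  "mod_coproduct I M =
     submodule_on (mod_product I M)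
       {x \<in> carrier (mod_product I M). finite {i \<in> I. x i \<noteq> \<zero>\<^bsub>M i\<^esub>}}"

text \<open>
  The Pontrjagin dual swaps sides: with \<open>(a f) x = f (a x)\<close> the dual of a left module satisfies the
  associativity law of a right module, and vice versa.
\<close>

definition mod_dual :: "('r, 'm) module \<Rightarrow> ('r, 'm \<Rightarrow> qz) module" where
  "mod_dual M =
     \<lparr>carrier = {f \<in> extensional (carrier M).
        \<forall>x\<in>carrier M. \<forall>y\<in>carrier M. f (x \<oplus>\<^bsub>M\<^esub> y) = f x + f y},
      mult = undefined, one = undefined,
      zero = (\<lambda>x\<in>carrier M. 0),
      add = (\<lambda>f g. \<lambda>x\<in>carrier M. f x + g x),
      smult = (\<lambda>a f. \<lambda>x\<in>carrier M. f (a \<odot>\<^bsub>M\<^esub> x))\<rparr>"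


section \<open>Complexes of modules\<close>

text \<open>\<^term>\<open>bdy X n\<close> maps degree \<open>n\<close> to degree \<open>n - 1\<close>.\<close>

record ('r, 'm) mod_complex =
  obj :: "int \<Rightarrow> ('r, 'm) module"
  bdy :: "int \<Rightarrow> 'm \<Rightarrow> 'm"

definition is_complex ::
  "side \<Rightarrow> ('r, 'k) ring_scheme \<Rightarrow> ('r, 'm) mod_complex \<Rightarrow> bool" where
  "is_complex s R X \<longleftrightarrow>
     (\<forall>n. is_module s R (obj X n)) \<and>
     (\<forall>n. bdy X n \<in> mod_hom R (obj X n) (obj X (n - 1))) \<and>
     (\<forall>n. \<forall>x\<in>carrier (obj X n). bdy X (n - 1) (bdy X n x) = \<zero>\<^bsub>obj X (n - 2)\<^esub>)"

definition cycles :: "('r, 'm) mod_complex \<Rightarrow> int \<Rightarrow> ('r, 'm) module" where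
  "cycles X n =
     submodule_on (obj X n) {x \<in> carrier (obj X n). bdy X n x = \<zero>\<^bsub>obj X (n - 1)\<^esub>}"

definition exact_complex :: "('r, 'm) mod_complex \<Rightarrow> bool" where
  "exact_complex X \<longleftrightarrow>
     (\<forall>n. carrier (cycles X n) = bdy X (n + 1) ` carrier (obj X (n + 1)))"

definition chain_map ::
  "('r, 'k) ring_scheme \<Rightarrow> ('r, 'm) mod_complex \<Rightarrow> ('r, 'n) mod_complex \<Rightarrow>
   (int \<Rightarrow> 'm \<Rightarrow> 'n) set" where
  "chain_map R X Y =
     {f. \<forall>n. f n \<in> mod_hom R (obj X n) (obj Y n) \<and>
         (\<forall>x\<in>carrier (obj X n). f (n - 1) (bdy X n x) = bdy Y n (f n x))}"

definition cx_isomorphic ::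
  "('r, 'k) ring_scheme \<Rightarrow> ('r, 'm) mod_complex \<Rightarrow> ('r, 'n) mod_complex \<Rightarrow> bool" where
  "cx_isomorphic R X Y \<longleftrightarrow>
     (\<exists>f\<in>chain_map R X Y. \<forall>n. bij_betw (f n) (carrier (obj X n)) (carrier (obj Y n)))"

definition cx_short_exact ::
  "('r, 'k) ring_scheme \<Rightarrow> ('r, 'l) mod_complex \<Rightarrow> (int \<Rightarrow> 'l \<Rightarrow> 'm) \<Rightarrow>
   ('r, 'm) mod_complex \<Rightarrow> (int \<Rightarrow> 'm \<Rightarrow> 'n) \<Rightarrow> ('r, 'n) mod_complex \<Rightarrow> bool" where
  "cx_short_exact R X f Y g Z \<longleftrightarrow>
     f \<in> chain_map R X Y \<and> g \<in> chain_map R Y Z \<and>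
     (\<forall>n. mod_short_exact R (obj X n) (f n) (obj Y n) (g n) (obj Z n))"

definition cx_product ::
  "'i set \<Rightarrow> ('i \<Rightarrow> ('r, 'm) mod_complex) \<Rightarrow> ('r, 'i \<Rightarrow> 'm) mod_complex" where
  "cx_product I X =
     \<lparr>obj = (\<lambda>n. mod_product I (\<lambda>i. obj (X i) n)),
      bdy = (\<lambda>n x. \<lambda>i\<in>I. bdy (X i) n (x i))\<rparr>"

definition cx_coproduct ::
  "'i set \<Rightarrow> ('i \<Rightarrow> ('r, 'm) mod_complex) \<Rightarrow> ('r, 'i \<Rightarrow> 'm) mod_complex" where
  "cx_coproduct I X =
     \<lparr>obj = (\<lambda>n. mod_coproduct I (\<lambda>i. obj (X i) n)),
      bdy = (\<lambda>n x. \<lambda>i\<in>I. bdy (X i) n (x i))\<rparr>"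

definition cx_dual :: "('r, 'm) mod_complex \<Rightarrow> ('r, 'm \<Rightarrow> qz) mod_complex" where
  "cx_dual X =
     \<lparr>obj = (\<lambda>n. mod_dual (obj X (- n - 2))),
      bdy = (\<lambda>n f. \<lambda>x\<in>carrier (obj X (- n - 1)).
        (if even n then f (bdy X (- n - 1) x) else - f (bdy X (- n - 1) x)))\<rparr>"

definition disc0 :: "('r, 'm) module \<Rightarrow> ('r, 'm) mod_complex" where
  "disc0 M =
     \<lparr>obj = (\<lambda>n. if n = 0 \<or> n = -1 then M else submodule_on M {\<zero>\<^bsub>M\<^esub>}),
      bdy = (\<lambda>n x. if n = 0 then x else \<zero>\<^bsub>M\<^esub>)\<rparr>"


section \<open>Duality pairs of modules\<close>

text \<open>
  A class of modules is a set of modules whose elements are taken from a type \<open>'m\<close>, which plays the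
  role of the universe; it is an arbitrary type. The duals of the modules over \<open>'m\<close> have their
  elements in \<open>'m \<Rightarrow> qz\<close>, so a duality pair relates a class over \<open>'m\<close> to a class over \<open>'m \<Rightarrow> qz\<close>.

  Sums and products live over yet another type. They are identified with modules over \<open>'m\<close> through
  isomorphism: being closed under a construction means that every module over \<open>'m\<close> isomorphic to
  its outcome is in the class. The type of the index sets of products and coproducts, again
  arbitrary, is passed as an argument.
\<close>

text \<open>
  The complement \<open>B\<close> may be taken over the same type as \<open>N\<close>, because it is isomorphic to a submodule
  of \<open>N\<close>. The case \<open>B = 0\<close> yields closure under isomorphism.
\<close>

definition mod_summand_closed ::
  "side \<Rightarrow> ('r, 'k) ring_scheme \<Rightarrow> ('r, 'm) module set \<Rightarrow> bool" where
  "mod_summand_closed s R \<C> \<longleftrightarrow>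
     (\<forall>N\<in>\<C>. \<forall>A B. is_module s R A \<and> is_module s R B \<and>
        mod_isomorphic R N (mod_coproduct UNIV (\<lambda>b::bool. if b then A else B)) \<longrightarrow> A \<in> \<C>)"

text \<open>The empty direct sum, that is the zero module, is included.\<close>

definition mod_finite_sum_closed ::
  "side \<Rightarrow> ('r, 'k) ring_scheme \<Rightarrow> ('r, 'm) module set \<Rightarrow> bool" where
  "mod_finite_sum_closed s R \<C> \<longleftrightarrow>
     (\<forall>(n::nat) N P. (\<forall>i<n. N i \<in> \<C>) \<and> is_module s R P \<and>
        mod_isomorphic R P (mod_coproduct {..<n} N) \<longrightarrow> P \<in> \<C>)"

definition mod_product_closed ::
  "'i itself \<Rightarrow> side \<Rightarrow> ('r, 'k) ring_scheme \<Rightarrow> ('r, 'm) module set \<Rightarrow> bool" where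
  "mod_product_closed _ s R \<M> \<longleftrightarrow>
     (\<forall>(I::'i set) N P. (\<forall>i\<in>I. N i \<in> \<M>) \<and> is_module s R P \<and>
        mod_isomorphic R P (mod_product I N) \<longrightarrow> P \<in> \<M>)"

definition mod_coproduct_closed ::
  "'i itself \<Rightarrow> side \<Rightarrow> ('r, 'k) ring_scheme \<Rightarrow> ('r, 'm) module set \<Rightarrow> bool" where
  "mod_coproduct_closed _ s R \<M> \<longleftrightarrow>
     (\<forall>(I::'i set) N P. (\<forall>i\<in>I. N i \<in> \<M>) \<and> is_module s R P \<and>
        mod_isomorphic R P (mod_coproduct I N) \<longrightarrow> P \<in> \<M>)"

definition mod_extension_closed ::
  "side \<Rightarrow> ('r, 'k) ring_scheme \<Rightarrow> ('r, 'm) module set \<Rightarrow> bool" where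
  "mod_extension_closed s R \<M> \<longleftrightarrow>
     (\<forall>L M N f g. L \<in> \<M> \<and> N \<in> \<M> \<and> is_module s R M \<and>
        mod_short_exact R L f M g N \<longrightarrow> M \<in> \<M>)"

definition duality_pair ::
  "side \<Rightarrow> ('r, 'k) ring_scheme \<Rightarrow>
   ('r, 'm) module set \<Rightarrow> ('r, 'm \<Rightarrow> qz) module set \<Rightarrow> bool" where
  "duality_pair s R \<M> \<C> \<longleftrightarrow>
     \<M> \<subseteq> Collect (is_module s R) \<and>
     \<C> \<subseteq> Collect (is_module (opposite s) R) \<and>
     (\<forall>M. is_module s R M \<longrightarrow> (M \<in> \<M> \<longleftrightarrow> mod_dual M \<in> \<C>)) \<and>
     mod_summand_closed (opposite s) R \<C> \<and>
     mod_finite_sum_closed (opposite s) R \<C>"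

definition product_closed_duality_pair ::
  "'i itself \<Rightarrow> side \<Rightarrow> ('r, 'k) ring_scheme \<Rightarrow>
   ('r, 'm) module set \<Rightarrow> ('r, 'm \<Rightarrow> qz) module set \<Rightarrow> bool" where
  "product_closed_duality_pair T s R \<M> \<C> \<longleftrightarrow>
     duality_pair s R \<M> \<C> \<and> mod_product_closed T s R \<M>"

definition coproduct_closed_duality_pair ::
  "'i itself \<Rightarrow> side \<Rightarrow> ('r, 'k) ring_scheme \<Rightarrow>
   ('r, 'm) module set \<Rightarrow> ('r, 'm \<Rightarrow> qz) module set \<Rightarrow> bool" where
  "coproduct_closed_duality_pair T s R \<M> \<C> \<longleftrightarrow>
     duality_pair s R \<M> \<C> \<and> mod_coproduct_closed T s R \<M>"

definition perfect_duality_pair ::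
  "'i itself \<Rightarrow> side \<Rightarrow> ('r, 'k) ring_scheme \<Rightarrow>
   ('r, 'm) module set \<Rightarrow> ('r, 'm \<Rightarrow> qz) module set \<Rightarrow> bool" where
  "perfect_duality_pair T s R \<M> \<C> \<longleftrightarrow>
     coproduct_closed_duality_pair T s R \<M> \<C> \<and>
     mod_extension_closed s R \<M> \<and>
     (\<exists>N\<in>\<M>. mod_isomorphic R N (regular_module s R))"


section \<open>Dual pairs of complexes\<close>

definition cx_summand_closed ::
  "side \<Rightarrow> ('r, 'k) ring_scheme \<Rightarrow> ('r, 'm) mod_complex set \<Rightarrow> bool" where
  "cx_summand_closed s R \<C> \<longleftrightarrow>
     (\<forall>Y\<in>\<C>. \<forall>A B. is_complex s R A \<and> is_complex s R B \<and>
        cx_isomorphic R Y (cx_coproduct UNIV (\<lambda>b::bool. if b then A else B)) \<longrightarrow> A \<in> \<C>)"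

definition cx_finite_sum_closed ::
  "side \<Rightarrow> ('r, 'k) ring_scheme \<Rightarrow> ('r, 'm) mod_complex set \<Rightarrow> bool" where
  "cx_finite_sum_closed s R \<C> \<longleftrightarrow>
     (\<forall>(n::nat) Y P. (\<forall>i<n. Y i \<in> \<C>) \<and> is_complex s R P \<and>
        cx_isomorphic R P (cx_coproduct {..<n} Y) \<longrightarrow> P \<in> \<C>)"

definition cx_product_closed ::
  "'i itself \<Rightarrow> side \<Rightarrow> ('r, 'k) ring_scheme \<Rightarrow> ('r, 'm) mod_complex set \<Rightarrow> bool" where
  "cx_product_closed _ s R \<M> \<longleftrightarrow>
     (\<forall>(I::'i set) X P. (\<forall>i\<in>I. X i \<in> \<M>) \<and> is_complex s R P \<and>
        cx_isomorphic R P (cx_product I X) \<longrightarrow> P \<in> \<M>)"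

definition cx_coproduct_closed ::
  "'i itself \<Rightarrow> side \<Rightarrow> ('r, 'k) ring_scheme \<Rightarrow> ('r, 'm) mod_complex set \<Rightarrow> bool" where
  "cx_coproduct_closed _ s R \<M> \<longleftrightarrow>
     (\<forall>(I::'i set) X P. (\<forall>i\<in>I. X i \<in> \<M>) \<and> is_complex s R P \<and>
        cx_isomorphic R P (cx_coproduct I X) \<longrightarrow> P \<in> \<M>)"

definition cx_extension_closed ::
  "side \<Rightarrow> ('r, 'k) ring_scheme \<Rightarrow> ('r, 'm) mod_complex set \<Rightarrow> bool" where
  "cx_extension_closed s R \<M> \<longleftrightarrow>
     (\<forall>X Y Z f g. X \<in> \<M> \<and> Z \<in> \<M> \<and> is_complex s R Y \<and>
        cx_short_exact R X f Y g Z \<longrightarrow> Y \<in> \<M>)"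

definition dual_pair ::
  "side \<Rightarrow> ('r, 'k) ring_scheme \<Rightarrow>
   ('r, 'm) mod_complex set \<Rightarrow> ('r, 'm \<Rightarrow> qz) mod_complex set \<Rightarrow> bool" where
  "dual_pair s R \<M> \<C> \<longleftrightarrow>
     \<M> \<subseteq> Collect (is_complex s R) \<and>
     \<C> \<subseteq> Collect (is_complex (opposite s) R) \<and>
     (\<forall>X. is_complex s R X \<longrightarrow> (X \<in> \<M> \<longleftrightarrow> cx_dual X \<in> \<C>)) \<and>
     cx_summand_closed (opposite s) R \<C> \<and>
     cx_finite_sum_closed (opposite s) R \<C>"

definition product_closed_dual_pair ::
  "'i itself \<Rightarrow> side \<Rightarrow> ('r, 'k) ring_scheme \<Rightarrow>
   ('r, 'm) mod_complex set \<Rightarrow> ('r, 'm \<Rightarrow> qz) mod_complex set \<Rightarrow> bool" where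
  "product_closed_dual_pair T s R \<M> \<C> \<longleftrightarrow>
     dual_pair s R \<M> \<C> \<and> cx_product_closed T s R \<M>"

definition coproduct_closed_dual_pair ::
  "'i itself \<Rightarrow> side \<Rightarrow> ('r, 'k) ring_scheme \<Rightarrow>
   ('r, 'm) mod_complex set \<Rightarrow> ('r, 'm \<Rightarrow> qz) mod_complex set \<Rightarrow> bool" where
  "coproduct_closed_dual_pair T s R \<M> \<C> \<longleftrightarrow>
     dual_pair s R \<M> \<C> \<and> cx_coproduct_closed T s R \<M>"

definition perfect_dual_pair ::
  "'i itself \<Rightarrow> side \<Rightarrow> ('r, 'k) ring_scheme \<Rightarrow>
   ('r, 'm) mod_complex set \<Rightarrow> ('r, 'm \<Rightarrow> qz) mod_complex set \<Rightarrow> bool" where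
  "perfect_dual_pair T s R \<M> \<C> \<longleftrightarrow>
     coproduct_closed_dual_pair T s R \<M> \<C> \<and>
     cx_extension_closed s R \<M> \<and>
     (\<exists>X\<in>\<M>. cx_isomorphic R X (disc0 (regular_module s R)))"


section \<open>Classes of complexes built from a class of modules\<close>

definition dw_class ::
  "side \<Rightarrow> ('r, 'k) ring_scheme \<Rightarrow> ('r, 'm) module set \<Rightarrow> ('r, 'm) mod_complex set" where
  "dw_class s R \<M> = {X. is_complex s R X \<and> (\<forall>n. obj X n \<in> \<M>)}"

definition ex_class ::
  "side \<Rightarrow> ('r, 'k) ring_scheme \<Rightarrow> ('r, 'm) module set \<Rightarrow> ('r, 'm) mod_complex set" where
  "ex_class s R \<M> = {X \<in> dw_class s R \<M>. exact_complex X}"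

definition tilde_class ::
  "side \<Rightarrow> ('r, 'k) ring_scheme \<Rightarrow> ('r, 'm) module set \<Rightarrow> ('r, 'm) mod_complex set" where
  "tilde_class s R \<M> =
     {X. is_complex s R X \<and> exact_complex X \<and> (\<forall>n. cycles X n \<in> \<M>)}"

end

theory Submission
  imports Defs
begin

text \<open>
  The three constructions are treated at once. Each attaches to a complex \<open>X\<close> its pieces, which are
  its terms or its cycle modules, possibly demands that \<open>X\<close> is exact, and asks for all pieces to
  lie in the given class of modules. The theorem then says that dual pairs of such classes and
  duality pairs of modules are the same thing, and two observations account for it.

  From modules to complexes: for complexes that satisfy the exactness demand, forming pieces commutes
  with everything in sight. For products, coproducts and terms of the dual this holds by
  construction. For extensions of exact complexes it is a diagram chase that produces short exact
  sequences of cycles (\<open>cx_short_exact_middle_exact\<close>, \<open>cx_short_exact_cycles\<close>). For cycles of the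
  dual it rests on properties of \<open>\<rat>/\<int>\<close>: being injective and a cogenerator, it makes the dual
  of \<open>X\<close> exact iff \<open>X\<close> is (\<open>exact_cx_dual\<close>), and for exact \<open>X\<close> the cycles of the dual
  are the duals of the cycles (\<open>dual_cycles_isomorphic\<close>). The class \<open>\<C>\<close> is closed under
  isomorphism, as it is closed under direct summands, so this is all that is needed for
  \<open>cx_dual_in_kind_class\<close>.

  From complexes to modules: the exact complex \<open>0 \<rightarrow> M = M \<rightarrow> 0\<close> has only \<open>M\<close> and zero modules as terms and
  as cycles. Zero modules are in all classes concerned because of empty sums, so the complex lies
  in a class iff \<open>M\<close> does, and as it depends additively and exactly on \<open>M\<close>, each property of the
  classes of complexes can be evaluated at these complexes.
\<close>

section \<open>Extending characters with values in the rationals modulo the integers\<close>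

lift_definition qz_scale :: "int \<Rightarrow> qz \<Rightarrow> qz" is "\<lambda>n q. of_int n * q"
proof -
  fix n :: int and a b :: rat
  assume "qz_rel a b"
  then have "of_int n * (a - b) \<in> \<int>" unfolding qz_rel_def by (intro Ints_mult) auto
  then show "qz_rel (of_int n * a) (of_int n * b)" unfolding qz_rel_def by (simp add: algebra_simps)
qed

lemma qz_scale_zero [simp]: "qz_scale 0 q = 0"
  by transfer (simp add: qz_rel_def)

lemma qz_scale_one [simp]: "qz_scale 1 q = q"
  by transfer (simp add: qz_rel_def)

lemma qz_scale_add: "qz_scale (m + n) q = qz_scale m q + qz_scale n q"
  by transfer (simp add: qz_rel_def algebra_simps)

lemma qz_scale_minus: "qz_scale (- n) q = - qz_scale n q"
  by transfer (simp add: qz_rel_def)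

lemma qz_scale_scale: "qz_scale m (qz_scale n q) = qz_scale (m * n) q"
  by transfer (simp add: qz_rel_def algebra_simps)

lemma qz_divisible_nonzero:
  assumes "m \<ge> 2"
  obtains q where "q \<noteq> 0" "qz_scale m q = w"
proof -
  have "\<forall>w. \<exists>q. q \<noteq> 0 \<and> qz_scale m q = w"
  proof (transfer fixing: m, intro allI)
    fix w :: rat
    \<comment> \<open>The quotient \<open>w / m\<close> may be an integer when \<open>w\<close> is; then \<open>1 / m\<close> replaces it.\<close>
    let ?q = "if w \<in> \<int> then 1 / of_int m else w / of_int m"
    have m: "(of_int m :: rat) \<noteq> 0" using assms by simp
    have "1 / (of_int m :: rat) \<notin> \<int>"
    proof
      assume "1 / (of_int m :: rat) \<in> \<int>"
      then obtain k :: int where "1 / (of_int m :: rat) = of_int k" by (auto elim: Ints_cases)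
      then have "(1 :: rat) = of_int (k * m)" using m by (simp add: field_simps)
      then have "k * m = 1" by (metis of_int_1 of_int_eq_iff)
      then show False using assms by (simp add: zmult_eq_1_iff)
    qed
    moreover have "w / of_int m \<notin> \<int>" if "w \<notin> \<int>"
    proof
      assume "w / of_int m \<in> \<int>"
      then have "of_int m * (w / of_int m) \<in> \<int>" by (intro Ints_mult) auto
      then show False using m that by simp
    qed
    moreover have "qz_rel (of_int m * ?q) w"
      using m by (auto simp: qz_rel_def)
    ultimately show "\<exists>q. \<not> qz_rel q 0 \<and> qz_rel (of_int m * q) w"
      by (intro exI[of _ ?q]) (auto simp: qz_rel_def)
  qed
  then show ?thesis using that by blast
qed

text \<open>
  The graph of a homomorphism from a subgroup of \<open>M\<close> to \<open>\<rat>/\<int>\<close>. Working with graphs turns unions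
  of chains into unions of sets, which is what Zorn's lemma asks for.
\<close>

definition partial_character :: "('r, 'm) module \<Rightarrow> ('m \<times> qz) set \<Rightarrow> bool" where
  "partial_character M G \<longleftrightarrow>
     G \<subseteq> carrier M \<times> UNIV \<and> (\<zero>\<^bsub>M\<^esub>, 0) \<in> G \<and>
     (\<forall>x u y v. (x, u) \<in> G \<longrightarrow> (y, v) \<in> G \<longrightarrow> (x \<oplus>\<^bsub>M\<^esub> y, u + v) \<in> G) \<and>
     (\<forall>x u. (x, u) \<in> G \<longrightarrow> (\<ominus>\<^bsub>M\<^esub> x, - u) \<in> G) \<and>
     (\<forall>v. (\<zero>\<^bsub>M\<^esub>, v) \<in> G \<longrightarrow> v = 0)"

lemma add_pow_zero: "[(0 :: int)] \<cdot>\<^bsub>M\<^esub> x = \<zero>\<^bsub>M\<^esub>"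
  by (simp add: add_pow_def)

lemma partial_character_carrier: "partial_character M G \<Longrightarrow> (x, u) \<in> G \<Longrightarrow> x \<in> carrier M"
  unfolding partial_character_def by blast

lemma partial_character_zero: "partial_character M G \<Longrightarrow> (\<zero>\<^bsub>M\<^esub>, 0) \<in> G"
  unfolding partial_character_def by blast

lemma partial_character_add:
  "partial_character M G \<Longrightarrow> (x, u) \<in> G \<Longrightarrow> (y, v) \<in> G \<Longrightarrow> (x \<oplus>\<^bsub>M\<^esub> y, u + v) \<in> G"
  unfolding partial_character_def by blast

lemma partial_character_minus:
  "partial_character M G \<Longrightarrow> (x, u) \<in> G \<Longrightarrow> (\<ominus>\<^bsub>M\<^esub> x, - u) \<in> G"
  unfolding partial_character_def by blast

lemma partial_character_at_zero: "partial_character M G \<Longrightarrow> (\<zero>\<^bsub>M\<^esub>, v) \<in> G \<Longrightarrow> v = 0"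
  unfolding partial_character_def by blast

lemma partial_character_unique:
  assumes "abelian_group M" "partial_character M G" "(x, u) \<in> G" "(x, v) \<in> G"
  shows "u = v"
proof -
  interpret abelian_group M by fact
  have "x \<in> carrier M" using partial_character_carrier[OF assms(2,3)] .
  then have "(\<zero>\<^bsub>M\<^esub>, u + - v) \<in> G"
    using partial_character_add[OF assms(2,3) partial_character_minus[OF assms(2,4)]]
    by (simp add: r_neg)
  then show ?thesis using partial_character_at_zero[OF assms(2)] by fastforce
qed

lemma partial_character_multiple:
  assumes "abelian_group M" "partial_character M G" "(x, u) \<in> G"
  shows "([(n :: int)] \<cdot>\<^bsub>M\<^esub> x, qz_scale n u) \<in> G"
proof -
  interpret abelian_group M by fact
  have x: "x \<in> carrier M" using partial_character_carrier[OF assms(2,3)] .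
  have nonneg: "([(int k)] \<cdot>\<^bsub>M\<^esub> x, qz_scale (int k) u) \<in> G" for k
  proof (induction k)
    case 0
    then show ?case using partial_character_zero[OF assms(2)] by (simp add: add_pow_zero)
  next
    case (Suc k)
    have "[(int (Suc k))] \<cdot>\<^bsub>M\<^esub> x = [(int k)] \<cdot>\<^bsub>M\<^esub> x \<oplus>\<^bsub>M\<^esub> x"
      using add.int_pow_mult[of x "int k" 1] x by (simp add: add.commute)
    moreover have "qz_scale (int (Suc k)) u = qz_scale (int k) u + u"
      using qz_scale_add[of "int k" 1 u] by (simp add: add.commute)
    ultimately show ?case using partial_character_add[OF assms(2) Suc assms(3)] by simp
  qed
  show ?thesis
  proof (cases "n \<ge> 0")
    case True
    then show ?thesis using nonneg[of "nat n"] by simp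
  next
    case False
    then have n: "n = - int (nat (- n))" by simp
    then have "[n] \<cdot>\<^bsub>M\<^esub> x = \<ominus>\<^bsub>M\<^esub> ([(int (nat (- n)))] \<cdot>\<^bsub>M\<^esub> x)"
      using add.int_pow_neg[OF x, of "int (nat (- n))"] by simp
    moreover have "qz_scale n u = - qz_scale (int (nat (- n))) u"
      using n qz_scale_minus by metis
    ultimately show ?thesis
      using partial_character_minus[OF assms(2) nonneg[of "nat (- n)"]] by simp
  qed
qed

text \<open>
  The multiples of \<open>x\<close> that already lie in the domain form a subgroup \<open>m\<int>\<close> of \<open>\<int>\<close>, so a value at
  \<open>x\<close> is admissible once \<open>m\<close> times it is the prescribed one. If \<open>m = 0\<close> any value will do,
  and \<open>m = 1\<close> is impossible since \<open>x\<close> is outside the domain; this leaves room for a nonzero value.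
\<close>

lemma partial_character_admissible_value:
  assumes "abelian_group M" "partial_character M G" "x \<in> carrier M" "x \<notin> Domain G"
  obtains q where "q \<noteq> 0" "\<And>n v. ([(n :: int)] \<cdot>\<^bsub>M\<^esub> x, v) \<in> G \<Longrightarrow> v = qz_scale n q"
proof (cases "\<exists>n > 0. [(int n)] \<cdot>\<^bsub>M\<^esub> x \<in> Domain G")
  case False
  interpret abelian_group M by fact
  have no_multiple: "n = 0" if "([(n :: int)] \<cdot>\<^bsub>M\<^esub> x, v) \<in> G" for n v
  proof (rule ccontr)
    assume "n \<noteq> 0"
    then consider "n > 0" | "- n > 0" by linarith
    then show False
    proof cases
      case 1
      then have "[(int (nat n))] \<cdot>\<^bsub>M\<^esub> x \<in> Domain G" "nat n > 0" using that by auto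
      then show False using False by blast
    next
      case 2
      have "([(- n)] \<cdot>\<^bsub>M\<^esub> x, - v) \<in> G"
        using partial_character_minus[OF assms(2) that] add.int_pow_neg[OF assms(3)] by simp
      then have "[(int (nat (- n)))] \<cdot>\<^bsub>M\<^esub> x \<in> Domain G" "nat (- n) > 0" using 2 by auto
      then show False using False by blast
    qed
  qed
  obtain q where q: "q \<noteq> 0" "qz_scale 2 q = 0" using qz_divisible_nonzero[of 2 0] by auto
  show ?thesis
  proof (rule that[OF q(1)])
    fix n :: int and v assume v: "([n] \<cdot>\<^bsub>M\<^esub> x, v) \<in> G"
    then have "n = 0" by (rule no_multiple)
    then show "v = qz_scale n q"
      using v partial_character_at_zero[OF assms(2)] by (simp add: add_pow_zero)
  qed
next
  case True
  interpret abelian_group M by fact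
  define m where "m = (LEAST n. n > 0 \<and> [(int n)] \<cdot>\<^bsub>M\<^esub> x \<in> Domain G)"
  have m: "m > 0" "[(int m)] \<cdot>\<^bsub>M\<^esub> x \<in> Domain G"
    using LeastI_ex[of "\<lambda>n. n > 0 \<and> [(int n)] \<cdot>\<^bsub>M\<^esub> x \<in> Domain G"] True unfolding m_def by auto
  have least: "m \<le> n" if "n > 0" "[(int n)] \<cdot>\<^bsub>M\<^esub> x \<in> Domain G" for n
    using that unfolding m_def by (auto intro: Least_le)
  have "m \<noteq> 1" using m assms(3,4) add.int_pow_1 by auto
  then have "int m \<ge> 2" using m(1) by linarith
  obtain w where w: "([(int m)] \<cdot>\<^bsub>M\<^esub> x, w) \<in> G" using m(2) by blast
  obtain q where q: "q \<noteq> 0" "qz_scale (int m) q = w"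
    using qz_divisible_nonzero[OF \<open>int m \<ge> 2\<close>] by metis
  show ?thesis
  proof (rule that[OF q(1)])
    fix n :: int and v assume v: "([n] \<cdot>\<^bsub>M\<^esub> x, v) \<in> G"
    define k r where "k = n div int m" and "r = n mod int m"
    have n: "n = r + int m * k" unfolding k_def r_def by simp
    have r: "0 \<le> r" "r < int m" using m(1) unfolding r_def by auto
    have mk: "([(int m * k)] \<cdot>\<^bsub>M\<^esub> x, qz_scale k w) \<in> G"
      using partial_character_multiple[OF assms(1,2) w, of k] add.int_pow_pow[OF assms(3)]
      by (simp add: mult.commute)
    have "([r] \<cdot>\<^bsub>M\<^esub> x, v - qz_scale k w) \<in> G"
    proof -
      have "[r] \<cdot>\<^bsub>M\<^esub> x = [n] \<cdot>\<^bsub>M\<^esub> x \<oplus>\<^bsub>M\<^esub> (\<ominus>\<^bsub>M\<^esub> ([(int m * k)] \<cdot>\<^bsub>M\<^esub> x))"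
        using add.int_pow_mult[OF assms(3), of n "- (int m * k)"]
          add.int_pow_neg[OF assms(3)] n by simp
      then show ?thesis
        using partial_character_add[OF assms(2) v partial_character_minus[OF assms(2) mk]] by simp
    qed
    then have "[(int (nat r))] \<cdot>\<^bsub>M\<^esub> x \<in> Domain G" using r(1) by auto
    then have "r = 0" using least[of "nat r"] r by fastforce
    then have "v = qz_scale k w"
      using partial_character_unique[OF assms(1,2) v, of "qz_scale k w"] mk n by simp
    then show "v = qz_scale n q"
      using q(2) n \<open>r = 0\<close> by (auto simp: qz_scale_scale mult.commute)
  qed
qed

text \<open>
  One step serves two purposes. The enlarged domain shows that a maximal partial character is defined
  everywhere; the nonzero value shows that characters separate points from subgroups.
\<close>

lemma partial_character_step:
  assumes M: "abelian_group M" and G: "partial_character M G"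
    and x: "x \<in> carrier M" "x \<notin> Domain G"
  obtains H q where "partial_character M H" "G \<subseteq> H" "(x, q) \<in> H" "q \<noteq> 0"
proof -
  interpret abelian_group M by fact
  obtain q where q: "q \<noteq> 0" "\<And>n v. ([(n :: int)] \<cdot>\<^bsub>M\<^esub> x, v) \<in> G \<Longrightarrow> v = qz_scale n q"
    using partial_character_admissible_value[OF assms] by metis
  define H where "H = {(h \<oplus>\<^bsub>M\<^esub> [(n :: int)] \<cdot>\<^bsub>M\<^esub> x, v + qz_scale n q) | h v n. (h, v) \<in> G}"
  have HI: "(h \<oplus>\<^bsub>M\<^esub> [n] \<cdot>\<^bsub>M\<^esub> x, v + qz_scale n q) \<in> H" if "(h, v) \<in> G" for h v n
    using that unfolding H_def by blast
  have HE: "\<exists>h v n. (h, v) \<in> G \<and> h \<in> carrier M \<and> y = h \<oplus>\<^bsub>M\<^esub> [n] \<cdot>\<^bsub>M\<^esub> x \<and> u = v + qz_scale n q"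
    if "(y, u) \<in> H" for y u
    using that partial_character_carrier[OF G] unfolding H_def by blast
  have mult: "[(n :: int)] \<cdot>\<^bsub>M\<^esub> x \<in> carrier M" for n using x by simp
  have "partial_character M H"
    unfolding partial_character_def
  proof (intro conjI allI impI)
    show "H \<subseteq> carrier M \<times> UNIV" using HE mult by fastforce
    show "(\<zero>\<^bsub>M\<^esub>, 0) \<in> H"
      using HI[OF partial_character_zero[OF G], of 0] by (simp add: add_pow_zero)
  next
    fix y u z w assume "(y, u) \<in> H" "(z, w) \<in> H"
    then obtain h v n k v' n' where *: "(h, v) \<in> G" "h \<in> carrier M"
      "y = h \<oplus>\<^bsub>M\<^esub> [n] \<cdot>\<^bsub>M\<^esub> x" "u = v + qz_scale n q" "(k, v') \<in> G" "k \<in> carrier M"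
      "z = k \<oplus>\<^bsub>M\<^esub> [(n')] \<cdot>\<^bsub>M\<^esub> x" "w = v' + qz_scale n' q"
      using HE by meson
    have "y \<oplus>\<^bsub>M\<^esub> z = (h \<oplus>\<^bsub>M\<^esub> k) \<oplus>\<^bsub>M\<^esub> [(n + n')] \<cdot>\<^bsub>M\<^esub> x"
      using * mult add.int_pow_mult[OF x(1)] by (simp add: a_ac)
    moreover have "u + w = (v + v') + qz_scale (n + n') q"
      using * by (simp add: qz_scale_add)
    ultimately show "(y \<oplus>\<^bsub>M\<^esub> z, u + w) \<in> H"
      using HI[OF partial_character_add[OF G *(1,5)]] by simp
  next
    fix y u assume "(y, u) \<in> H"
    then obtain h v n where *: "(h, v) \<in> G" "h \<in> carrier M"
      "y = h \<oplus>\<^bsub>M\<^esub> [n] \<cdot>\<^bsub>M\<^esub> x" "u = v + qz_scale n q"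
      using HE by meson
    have "\<ominus>\<^bsub>M\<^esub> y = \<ominus>\<^bsub>M\<^esub> h \<oplus>\<^bsub>M\<^esub> [(- n)] \<cdot>\<^bsub>M\<^esub> x"
      using * mult add.int_pow_neg[OF x(1)] by (simp add: minus_add)
    moreover have "- u = - v + qz_scale (- n) q" using * by (simp add: qz_scale_minus)
    ultimately show "(\<ominus>\<^bsub>M\<^esub> y, - u) \<in> H"
      using HI[OF partial_character_minus[OF G *(1)], of "- n"] by simp
  next
    fix u assume "(\<zero>\<^bsub>M\<^esub>, u) \<in> H"
    then obtain h v n where *: "(h, v) \<in> G" "h \<in> carrier M"
      "\<zero>\<^bsub>M\<^esub> = h \<oplus>\<^bsub>M\<^esub> [n] \<cdot>\<^bsub>M\<^esub> x" "u = v + qz_scale n q"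
      using HE by meson
    have "h = [(- n)] \<cdot>\<^bsub>M\<^esub> x"
      using * mult add.int_pow_neg[OF x(1)] by (metis minus_equality minus_minus a_comm)
    then have "v = qz_scale (- n) q" using q(2) *(1) by simp
    then show "u = 0" using * by (simp add: qz_scale_minus)
  qed
  moreover have "G \<subseteq> H"
  proof
    fix p assume "p \<in> G"
    then obtain h v where p: "p = (h, v)" "(h, v) \<in> G" by (cases p) auto
    then show "p \<in> H"
      using HI[of h v 0] partial_character_carrier[OF G p(2)] by (simp add: add_pow_zero)
  qed
  moreover have "(x, q) \<in> H"
    using HI[OF partial_character_zero[OF G], of 1] x by (simp add: add.int_pow_1)
  ultimately show ?thesis using that q(1) by blast
qed

text \<open>By Zorn's lemma there is a maximal graph, and by the previous step it leaves out no element.\<close>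

lemma partial_character_extends:
  assumes M: "abelian_group M" and G: "partial_character M G"
  obtains f where "f \<in> carrier (mod_dual M)" "\<And>x u. (x, u) \<in> G \<Longrightarrow> f x = u"
proof -
  interpret abelian_group M by fact
  let ?A = "{H. partial_character M H \<and> G \<subseteq> H}"
  have "\<exists>H\<in>?A. \<forall>K\<in>?A. H \<subseteq> K \<longrightarrow> K = H"
  proof (rule subset_Zorn_nonempty)
    show "?A \<noteq> {}" using G by blast
  next
    fix C assume "C \<noteq> {}" and chain: "subset.chain ?A C"
    have char: "partial_character M H" "G \<subseteq> H" if "H \<in> C" for H
      using chain that unfolding subset.chain_def by auto
    have total: "H \<subseteq> K \<or> K \<subseteq> H" if "H \<in> C" "K \<in> C" for H K
      using chain that unfolding subset.chain_def by blast
    have "partial_character M (\<Union>C)"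
      unfolding partial_character_def
    proof (intro conjI allI impI)
      show "\<Union>C \<subseteq> carrier M \<times> UNIV" using char(1) partial_character_carrier by fastforce
      show "(\<zero>\<^bsub>M\<^esub>, 0) \<in> \<Union>C" using \<open>C \<noteq> {}\<close> char(1) partial_character_zero by fast
    next
      fix x u y v assume "(x, u) \<in> \<Union>C" "(y, v) \<in> \<Union>C"
      then obtain H K where "H \<in> C" "(x, u) \<in> H" "K \<in> C" "(y, v) \<in> K" by blast
      then obtain L where "L \<in> C" "(x, u) \<in> L" "(y, v) \<in> L" using total[of H K] by blast
      then show "(x \<oplus>\<^bsub>M\<^esub> y, u + v) \<in> \<Union>C" using partial_character_add[OF char(1)] by blast
    next
      fix x u assume "(x, u) \<in> \<Union>C"
      then show "(\<ominus>\<^bsub>M\<^esub> x, - u) \<in> \<Union>C" using partial_character_minus[OF char(1)] by blast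
    next
      fix v assume "(\<zero>\<^bsub>M\<^esub>, v) \<in> \<Union>C"
      then show "v = 0" using partial_character_at_zero[OF char(1)] by blast
    qed
    then show "\<Union>C \<in> ?A" using \<open>C \<noteq> {}\<close> char(2) by blast
  qed
  then obtain H where H: "partial_character M H" "G \<subseteq> H"
    and max: "\<And>K. partial_character M K \<Longrightarrow> H \<subseteq> K \<Longrightarrow> K = H"
    by (smt (verit) mem_Collect_eq subset_trans)
  have "x \<in> Domain H" if x: "x \<in> carrier M" for x
  proof (rule ccontr)
    assume "x \<notin> Domain H"
    then obtain K q where "partial_character M K" "H \<subseteq> K" "(x, q) \<in> K"
      using partial_character_step[OF M H(1) x] by metis
    then show False using max \<open>x \<notin> Domain H\<close> by blast
  qed
  then have "\<forall>x\<in>carrier M. \<exists>u. (x, u) \<in> H" by blast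
  then obtain g where g: "\<And>x. x \<in> carrier M \<Longrightarrow> (x, g x) \<in> H" by metis
  let ?f = "restrict g (carrier M)"
  have f: "?f x = u" if "(x, u) \<in> H" for x u
    using partial_character_unique[OF M H(1) g that] partial_character_carrier[OF H(1) that]
    by simp
  have "?f (x \<oplus>\<^bsub>M\<^esub> y) = ?f x + ?f y" if "x \<in> carrier M" "y \<in> carrier M" for x y
    using f[OF partial_character_add[OF H(1) g[OF that(1)] g[OF that(2)]]] that by simp
  then have "?f \<in> carrier (mod_dual M)" by (simp add: mod_dual_def)
  then show ?thesis using that f H(2) by blast
qed


section \<open>Modules, submodules and homomorphisms\<close>

lemma is_module_abelian_group: "is_module s R M \<Longrightarrow> abelian_group M"
  by (simp add: is_module_def)

lemma is_module_zero_closed: "is_module s R M \<Longrightarrow> \<zero>\<^bsub>M\<^esub> \<in> carrier M"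
  by (simp add: is_module_def abelian_group_def abelian_monoid.zero_closed)

lemma is_module_add_closed:
  "is_module s R M \<Longrightarrow> x \<in> carrier M \<Longrightarrow> y \<in> carrier M \<Longrightarrow> x \<oplus>\<^bsub>M\<^esub> y \<in> carrier M"
  by (simp add: is_module_def abelian_group_def abelian_monoid.a_closed)

lemma is_module_smult_closed:
  "is_module s R M \<Longrightarrow> a \<in> carrier R \<Longrightarrow> x \<in> carrier M \<Longrightarrow> a \<odot>\<^bsub>M\<^esub> x \<in> carrier M"
  by (simp add: is_module_def)

lemma is_module_smult_zero:
  assumes M: "is_module s R M" and a: "a \<in> carrier R"
  shows "a \<odot>\<^bsub>M\<^esub> \<zero>\<^bsub>M\<^esub> = \<zero>\<^bsub>M\<^esub>"
proof -
  interpret abelian_group M using M by (rule is_module_abelian_group)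
  have "a \<odot>\<^bsub>M\<^esub> (\<zero>\<^bsub>M\<^esub> \<oplus>\<^bsub>M\<^esub> \<zero>\<^bsub>M\<^esub>) = a \<odot>\<^bsub>M\<^esub> \<zero>\<^bsub>M\<^esub> \<oplus>\<^bsub>M\<^esub> a \<odot>\<^bsub>M\<^esub> \<zero>\<^bsub>M\<^esub>"
    using M a zero_closed unfolding is_module_def by blast
  then show ?thesis
    using add.r_cancel_one' is_module_smult_closed[OF M a zero_closed] by force
qed

lemma mod_hom_closed: "f \<in> mod_hom R M N \<Longrightarrow> x \<in> carrier M \<Longrightarrow> f x \<in> carrier N"
  by (auto simp: mod_hom_def)

lemma mod_hom_add:
  "f \<in> mod_hom R M N \<Longrightarrow> x \<in> carrier M \<Longrightarrow> y \<in> carrier M \<Longrightarrow> f (x \<oplus>\<^bsub>M\<^esub> y) = f x \<oplus>\<^bsub>N\<^esub> f y"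
  by (auto simp: mod_hom_def)

lemma mod_hom_smult:
  "f \<in> mod_hom R M N \<Longrightarrow> a \<in> carrier R \<Longrightarrow> x \<in> carrier M \<Longrightarrow> f (a \<odot>\<^bsub>M\<^esub> x) = a \<odot>\<^bsub>N\<^esub> f x"
  by (auto simp: mod_hom_def)

lemma mod_hom_zero:
  assumes "f \<in> mod_hom R M N" "abelian_group M" "abelian_group N"
  shows "f \<zero>\<^bsub>M\<^esub> = \<zero>\<^bsub>N\<^esub>"
proof -
  interpret M: abelian_group M by fact
  interpret N: abelian_group N by fact
  have "f (\<zero>\<^bsub>M\<^esub> \<oplus>\<^bsub>M\<^esub> \<zero>\<^bsub>M\<^esub>) = f \<zero>\<^bsub>M\<^esub> \<oplus>\<^bsub>N\<^esub> f \<zero>\<^bsub>M\<^esub>"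
    using mod_hom_add[OF assms(1)] by blast
  then show ?thesis
    using N.add.r_cancel_one' mod_hom_closed[OF assms(1) M.zero_closed] by force
qed

lemma mod_hom_minus:
  assumes "f \<in> mod_hom R M N" "abelian_group M" "abelian_group N" "x \<in> carrier M"
  shows "f (\<ominus>\<^bsub>M\<^esub> x) = \<ominus>\<^bsub>N\<^esub> f x"
proof -
  interpret M: abelian_group M by fact
  interpret N: abelian_group N by fact
  have "f (\<ominus>\<^bsub>M\<^esub> x) \<oplus>\<^bsub>N\<^esub> f x = \<zero>\<^bsub>N\<^esub>"
    using mod_hom_add[OF assms(1), of "\<ominus>\<^bsub>M\<^esub> x" x] assms(4) mod_hom_zero[OF assms(1-3)]
    by (simp add: M.l_neg)
  then show ?thesis
    using N.minus_equality mod_hom_closed[OF assms(1)] assms(4) by (metis M.a_inv_closed)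
qed

lemma submodule_on_simps [simp]:
  "carrier (submodule_on M A) = A"
  "\<zero>\<^bsub>submodule_on M A\<^esub> = \<zero>\<^bsub>M\<^esub>"
  "x \<oplus>\<^bsub>submodule_on M A\<^esub> y = x \<oplus>\<^bsub>M\<^esub> y"
  "a \<odot>\<^bsub>submodule_on M A\<^esub> x = a \<odot>\<^bsub>M\<^esub> x"
  by (simp_all add: submodule_on_def)

lemma submodule_on_carrier [simp]: "submodule_on M (carrier M) = M"
  by (simp add: submodule_on_def)

lemma submodule_on_submodule_on [simp]:
  "submodule_on (submodule_on M A) B = submodule_on M B"
  by (simp add: submodule_on_def)

lemma is_module_submodule_on:
  assumes M: "is_module s R M" and A: "A \<subseteq> carrier M" "\<zero>\<^bsub>M\<^esub> \<in> A"
    "\<And>x y. x \<in> A \<Longrightarrow> y \<in> A \<Longrightarrow> x \<oplus>\<^bsub>M\<^esub> y \<in> A"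
    "\<And>x. x \<in> A \<Longrightarrow> \<ominus>\<^bsub>M\<^esub> x \<in> A"
    "\<And>a x. a \<in> carrier R \<Longrightarrow> x \<in> A \<Longrightarrow> a \<odot>\<^bsub>M\<^esub> x \<in> A"
  shows "is_module s R (submodule_on M A)"
proof -
  interpret abelian_group M using M by (rule is_module_abelian_group)
  have sub: "x \<in> carrier M" if "x \<in> A" for x using A(1) that by blast
  have "abelian_group (submodule_on M A)"
  proof (rule abelian_groupI; simp)
    show "\<exists>y\<in>A. y \<oplus>\<^bsub>M\<^esub> x = \<zero>\<^bsub>M\<^esub>" if "x \<in> A" for x
      using A(4)[OF that] sub[OF that] l_neg by blast
  qed (use A sub in \<open>auto simp: a_ac\<close>)
  then show ?thesis
    using M A sub unfolding is_module_def by (cases s) auto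
qed

lemma is_module_zero_submodule:
  assumes "is_module s R M"
  shows "is_module s R (submodule_on M {\<zero>\<^bsub>M\<^esub>})"
proof -
  interpret abelian_group M using assms by (rule is_module_abelian_group)
  show ?thesis
    by (rule is_module_submodule_on[OF assms]) (auto simp: is_module_smult_zero[OF assms])
qed

lemma mod_isomorphicE:
  assumes "mod_isomorphic R M N"
  obtains f where "f \<in> mod_hom R M N" "bij_betw f (carrier M) (carrier N)"
  using assms by (auto simp: mod_isomorphic_def)

lemma mod_isomorphic_sym:
  assumes M: "is_module s R M" and iso: "mod_isomorphic R M N"
  shows "mod_isomorphic R N M"
proof -
  obtain f where f: "f \<in> mod_hom R M N" "bij_betw f (carrier M) (carrier N)"
    using iso by (rule mod_isomorphicE)
  let ?g = "inv_into (carrier M) f"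
  have g: "bij_betw ?g (carrier N) (carrier M)" using f(2) by (rule bij_betw_inv_into)
  have gc: "?g y \<in> carrier M" "f (?g y) = y" if "y \<in> carrier N" for y
    using that g f(2) by (auto simp: bij_betw_def f_inv_into_f)
  have gf: "?g (f x) = x" if "x \<in> carrier M" for x
    using f(2) that by (simp add: bij_betw_def)
  have "?g \<in> mod_hom R N M"
    unfolding mod_hom_def
  proof (intro CollectI conjI ballI)
    fix x y assume xy: "x \<in> carrier N" "y \<in> carrier N"
    have "f (?g x \<oplus>\<^bsub>M\<^esub> ?g y) = x \<oplus>\<^bsub>N\<^esub> y" using mod_hom_add[OF f(1)] gc xy by simp
    then show "?g (x \<oplus>\<^bsub>N\<^esub> y) = ?g x \<oplus>\<^bsub>M\<^esub> ?g y"
      using gf[OF is_module_add_closed[OF M gc(1)[OF xy(1)] gc(1)[OF xy(2)]]] by simp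
  next
    fix a y assume ay: "a \<in> carrier R" "y \<in> carrier N"
    have "f (a \<odot>\<^bsub>M\<^esub> ?g y) = a \<odot>\<^bsub>N\<^esub> y" using mod_hom_smult[OF f(1)] gc ay by simp
    then show "?g (a \<odot>\<^bsub>N\<^esub> y) = a \<odot>\<^bsub>M\<^esub> ?g y"
      using gf[OF is_module_smult_closed[OF M ay(1) gc(1)[OF ay(2)]]] by simp
  qed (use gc in auto)
  then show ?thesis using g by (auto simp: mod_isomorphic_def)
qed


section \<open>Products and coproducts of modules\<close>

text \<open>
  Products and coproducts share all of the arguments below, so they are treated as the two values
  of a flag that decides whether the families are required to have finite support.
\<close>

definition mod_rprod ::
  "bool \<Rightarrow> 'i set \<Rightarrow> ('i \<Rightarrow> ('r, 'm) module) \<Rightarrow> ('r, 'i \<Rightarrow> 'm) module" where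
  "mod_rprod fin I M =
     submodule_on (mod_product I M)
       {x \<in> carrier (mod_product I M). fin \<longrightarrow> finite {i \<in> I. x i \<noteq> \<zero>\<^bsub>M i\<^esub>}}"

lemma mod_product_eq_rprod: "mod_product I M = mod_rprod False I M"
  by (simp add: mod_rprod_def)

lemma mod_coproduct_eq_rprod: "mod_coproduct I M = mod_rprod True I M"
  by (simp add: mod_rprod_def mod_coproduct_def)

lemma carrier_mod_rprod:
  "x \<in> carrier (mod_rprod fin I M) \<longleftrightarrow>
     x \<in> extensional I \<and> (\<forall>i\<in>I. x i \<in> carrier (M i)) \<and>
     (fin \<longrightarrow> finite {i \<in> I. x i \<noteq> \<zero>\<^bsub>M i\<^esub>})"
  by (auto simp: mod_rprod_def mod_product_def PiE_iff)

lemma mod_rprod_simps [simp]: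
  "\<zero>\<^bsub>mod_rprod fin I M\<^esub> = (\<lambda>i\<in>I. \<zero>\<^bsub>M i\<^esub>)"
  "x \<oplus>\<^bsub>mod_rprod fin I M\<^esub> y = (\<lambda>i\<in>I. x i \<oplus>\<^bsub>M i\<^esub> y i)"
  "a \<odot>\<^bsub>mod_rprod fin I M\<^esub> x = (\<lambda>i\<in>I. a \<odot>\<^bsub>M i\<^esub> x i)"
  by (simp_all add: mod_rprod_def mod_product_def)

lemma carrier_mod_rprod_pointwise:
  assumes "x \<in> carrier (mod_rprod fin I M)" "y \<in> carrier (mod_rprod fin I M)"
    and "\<And>i. i \<in> I \<Longrightarrow> z i \<in> carrier (N i)"
    and "\<And>i. i \<in> I \<Longrightarrow> x i = \<zero>\<^bsub>M i\<^esub> \<Longrightarrow> y i = \<zero>\<^bsub>M i\<^esub> \<Longrightarrow> z i = \<zero>\<^bsub>N i\<^esub>"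
  shows "(\<lambda>i\<in>I. z i) \<in> carrier (mod_rprod fin I N)"
proof -
  have "{i \<in> I. (\<lambda>i\<in>I. z i) i \<noteq> \<zero>\<^bsub>N i\<^esub>} \<subseteq> {i \<in> I. x i \<noteq> \<zero>\<^bsub>M i\<^esub>} \<union> {i \<in> I. y i \<noteq> \<zero>\<^bsub>M i\<^esub>}"
    using assms(4) by auto
  then have "fin \<longrightarrow> finite {i \<in> I. (\<lambda>i\<in>I. z i) i \<noteq> \<zero>\<^bsub>N i\<^esub>}"
    using assms(1,2) unfolding carrier_mod_rprod by (blast intro: finite_subset)
  then show ?thesis
    using assms(3) unfolding carrier_mod_rprod by simp
qed

lemma is_module_mod_rprod:
  assumes M: "\<And>i. i \<in> I \<Longrightarrow> is_module s R (M i)"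
  shows "is_module s R (mod_rprod fin I M)"
proof -
  have grp: "abelian_group (M i)" if "i \<in> I" for i
    using M[OF that] by (rule is_module_abelian_group)
  have zero: "(\<lambda>i\<in>I. \<zero>\<^bsub>M i\<^esub>) \<in> carrier (mod_rprod fin I M)"
    using is_module_zero_closed[OF M] by (simp add: carrier_mod_rprod)
  have add: "(\<lambda>i\<in>I. x i \<oplus>\<^bsub>M i\<^esub> y i) \<in> carrier (mod_rprod fin I M)"
    if "x \<in> carrier (mod_rprod fin I M)" "y \<in> carrier (mod_rprod fin I M)" for x y
  proof (rule carrier_mod_rprod_pointwise[OF that])
    fix i assume i: "i \<in> I"
    show "x i \<oplus>\<^bsub>M i\<^esub> y i \<in> carrier (M i)"
      using that i is_module_add_closed[OF M[OF i]] by (auto simp: carrier_mod_rprod)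
    interpret abelian_group "M i" using grp[OF i] .
    show "x i \<oplus>\<^bsub>M i\<^esub> y i = \<zero>\<^bsub>M i\<^esub>" if "x i = \<zero>\<^bsub>M i\<^esub>" "y i = \<zero>\<^bsub>M i\<^esub>" using that by simp
  qed
  have smult: "(\<lambda>i\<in>I. a \<odot>\<^bsub>M i\<^esub> x i) \<in> carrier (mod_rprod fin I M)"
    if a: "a \<in> carrier R" and x: "x \<in> carrier (mod_rprod fin I M)" for a x
  proof (rule carrier_mod_rprod_pointwise[OF x x])
    fix i assume i: "i \<in> I"
    show "a \<odot>\<^bsub>M i\<^esub> x i \<in> carrier (M i)"
      using x i is_module_smult_closed[OF M[OF i] a] by (simp add: carrier_mod_rprod)
    show "a \<odot>\<^bsub>M i\<^esub> x i = \<zero>\<^bsub>M i\<^esub>" if "x i = \<zero>\<^bsub>M i\<^esub>"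
      using is_module_smult_zero[OF M[OF i] a] that by simp
  qed
  have neg: "(\<lambda>i\<in>I. \<ominus>\<^bsub>M i\<^esub> x i) \<in> carrier (mod_rprod fin I M)"
    if x: "x \<in> carrier (mod_rprod fin I M)" for x
  proof (rule carrier_mod_rprod_pointwise[OF x x])
    fix i assume i: "i \<in> I"
    interpret abelian_group "M i" using grp[OF i] .
    show "\<ominus>\<^bsub>M i\<^esub> x i \<in> carrier (M i)" using x i by (auto simp: carrier_mod_rprod)
    show "\<ominus>\<^bsub>M i\<^esub> x i = \<zero>\<^bsub>M i\<^esub>" if "x i = \<zero>\<^bsub>M i\<^esub>" using that by simp
  qed
  have "abelian_group (mod_rprod fin I M)"
  proof (rule abelian_groupI; simp)
    show "(\<lambda>i\<in>I. (if i \<in> I then x i \<oplus>\<^bsub>M i\<^esub> y i else undefined) \<oplus>\<^bsub>M i\<^esub> z i) =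
        (\<lambda>i\<in>I. x i \<oplus>\<^bsub>M i\<^esub> (if i \<in> I then y i \<oplus>\<^bsub>M i\<^esub> z i else undefined))"
      if "x \<in> carrier (mod_rprod fin I M)" "y \<in> carrier (mod_rprod fin I M)"
        "z \<in> carrier (mod_rprod fin I M)" for x y z
      using that grp by (intro restrict_ext)
        (auto simp: carrier_mod_rprod abelian_monoid.a_assoc abelian_group_def)
    show "(\<lambda>i\<in>I. x i \<oplus>\<^bsub>M i\<^esub> y i) = (\<lambda>i\<in>I. y i \<oplus>\<^bsub>M i\<^esub> x i)"
      if "x \<in> carrier (mod_rprod fin I M)" "y \<in> carrier (mod_rprod fin I M)" for x y
      using that grp by (intro restrict_ext)
        (auto simp: carrier_mod_rprod abelian_monoid.a_comm abelian_group_def)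
    show "(\<lambda>i\<in>I. (if i \<in> I then \<zero>\<^bsub>M i\<^esub> else undefined) \<oplus>\<^bsub>M i\<^esub> x i) = x"
      if "x \<in> carrier (mod_rprod fin I M)" for x
      using that grp by (intro extensionalityI[of _ I])
        (auto simp: carrier_mod_rprod abelian_monoid.l_zero abelian_group_def)
    show "\<exists>y\<in>carrier (mod_rprod fin I M). (\<lambda>i\<in>I. y i \<oplus>\<^bsub>M i\<^esub> x i) = (\<lambda>i\<in>I. \<zero>\<^bsub>M i\<^esub>)"
      if "x \<in> carrier (mod_rprod fin I M)" for x
      by (rule bexI[OF _ neg[OF that]], rule restrict_ext)
        (use that grp in \<open>auto simp: carrier_mod_rprod abelian_group.l_neg\<close>)
  qed (use zero add in auto)
  moreover have "x i \<in> carrier (M i)" if "x \<in> carrier (mod_rprod fin I M)" "i \<in> I" for x i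
    using that by (simp add: carrier_mod_rprod)
  moreover have "x \<in> extensional I" if "x \<in> carrier (mod_rprod fin I M)" for x
    using that by (simp add: carrier_mod_rprod)
  ultimately show ?thesis
    using M smult unfolding is_module_def
    by (cases s) (auto intro!: restrict_ext extensionalityI[of _ I])
qed

text \<open>
  Splitting off a zero module turns closure under direct summands into closure under isomorphism,
  and the empty sum puts all zero modules into a class closed under finite sums.
\<close>

lemma isomorphic_sum_with_zero:
  assumes iso: "mod_isomorphic R N A" and Z: "is_module s R Z"
    and zero: "carrier Z = {\<zero>\<^bsub>Z\<^esub>}"
  shows "mod_isomorphic R N (mod_coproduct UNIV (\<lambda>b :: bool. if b then A else Z))"
proof -
  obtain f where f: "f \<in> mod_hom R N A" "bij_betw f (carrier N) (carrier A)"
    using iso by (rule mod_isomorphicE)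
  let ?S = "mod_rprod True UNIV (\<lambda>b :: bool. if b then A else Z)"
  let ?g = "\<lambda>x b. if b then f x else \<zero>\<^bsub>Z\<^esub>"
  have S: "x \<in> carrier ?S \<longleftrightarrow> x True \<in> carrier A \<and> x False = \<zero>\<^bsub>Z\<^esub>" for x
    by (auto simp: carrier_mod_rprod zero all_bool_eq)
  have "\<zero>\<^bsub>Z\<^esub> \<oplus>\<^bsub>Z\<^esub> \<zero>\<^bsub>Z\<^esub> = \<zero>\<^bsub>Z\<^esub>"
    using is_module_add_closed[OF Z] zero by simp
  then have "?g \<in> mod_hom R N ?S"
    using f(1) is_module_smult_zero[OF Z]
    by (auto simp: mod_hom_def S fun_eq_iff simp del: mod_rprod_simps(1))
  moreover have "bij_betw ?g (carrier N) (carrier ?S)"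
  proof (rule bij_betwI')
    fix x y assume "x \<in> carrier N" "y \<in> carrier N"
    then show "?g x = ?g y \<longleftrightarrow> x = y" using f(2) by (auto simp: bij_betw_def inj_on_def fun_eq_iff)
  next
    fix x assume "x \<in> carrier N"
    then show "?g x \<in> carrier ?S" using f(1) by (simp add: S mod_hom_closed)
  next
    fix y assume y: "y \<in> carrier ?S"
    then obtain x where "x \<in> carrier N" "f x = y True" using f(2) S by (metis bij_betw_def imageE)
    then show "\<exists>x\<in>carrier N. y = ?g x" using y by (intro bexI[of _ x]) (auto simp: S fun_eq_iff)
  qed
  ultimately show ?thesis
    by (auto simp: mod_isomorphic_def mod_coproduct_eq_rprod)
qed

lemma mod_summand_closed_isomorphic:
  assumes closed: "mod_summand_closed s R \<C>" and N: "N \<in> \<C>" and A: "is_module s R A" and iso: "mod_isomorphic R N A"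
  shows "A \<in> \<C>"
proof -
  have "is_module s R (submodule_on A {\<zero>\<^bsub>A\<^esub>})" using A by (rule is_module_zero_submodule)
  then show ?thesis
    using closed N A isomorphic_sum_with_zero[OF iso, of s "submodule_on A {\<zero>\<^bsub>A\<^esub>}"]
    unfolding mod_summand_closed_def by (auto 0 3)
qed

lemma isomorphic_empty_sum:
  assumes Z: "is_module s R Z" "carrier Z = {\<zero>\<^bsub>Z\<^esub>}"
  shows "mod_isomorphic R Z (mod_coproduct {..<0 :: nat} N)"
proof -
  let ?S = "mod_coproduct {..<0 :: nat} N"
  have S: "carrier ?S = {\<lambda>_. undefined}"
    by (auto simp: mod_coproduct_eq_rprod carrier_mod_rprod)
  have "(\<lambda>_ _. undefined) \<in> mod_hom R Z ?S"
    unfolding mod_hom_def S by (auto simp: mod_coproduct_eq_rprod restrict_def)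
  then show ?thesis
    using Z(2) S by (auto simp: mod_isomorphic_def bij_betw_def)
qed

lemma mod_finite_sum_closed_zero:
  assumes closed: "mod_finite_sum_closed s R \<C>"
    and Z: "is_module s R Z" "carrier Z = {\<zero>\<^bsub>Z\<^esub>}"
  shows "Z \<in> \<C>"
  using closed Z(1) isomorphic_empty_sum[OF Z] unfolding mod_finite_sum_closed_def
  by (metis less_nat_zero_code)


section \<open>Pontrjagin duals of modules\<close>

lemma carrier_mod_dual:
  "f \<in> carrier (mod_dual M) \<longleftrightarrow>
     f \<in> extensional (carrier M) \<and>
     (\<forall>x\<in>carrier M. \<forall>y\<in>carrier M. f (x \<oplus>\<^bsub>M\<^esub> y) = f x + f y)"
  by (simp add: mod_dual_def)

lemma mod_dual_simps [simp]:
  "\<zero>\<^bsub>mod_dual M\<^esub> = (\<lambda>x\<in>carrier M. 0)"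
  "f \<oplus>\<^bsub>mod_dual M\<^esub> g = (\<lambda>x\<in>carrier M. f x + g x)"
  "a \<odot>\<^bsub>mod_dual M\<^esub> f = (\<lambda>x\<in>carrier M. f (a \<odot>\<^bsub>M\<^esub> x))"
  by (simp_all add: mod_dual_def)

lemma character_zero:
  assumes "f \<in> carrier (mod_dual M)" "abelian_group M"
  shows "f \<zero>\<^bsub>M\<^esub> = 0"
proof -
  interpret abelian_group M by fact
  have "f (\<zero>\<^bsub>M\<^esub> \<oplus>\<^bsub>M\<^esub> \<zero>\<^bsub>M\<^esub>) = f \<zero>\<^bsub>M\<^esub> + f \<zero>\<^bsub>M\<^esub>"
    using assms(1) zero_closed unfolding carrier_mod_dual by blast
  then show ?thesis by simp
qed

lemma is_module_mod_dual:
  fixes M :: "('r, 'm) module"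
  assumes M: "is_module s R M"
  shows "is_module (opposite s) R (mod_dual M)"
proof -
  interpret abelian_group M using M by (rule is_module_abelian_group)
  have "abelian_group (mod_dual M)"
  proof (rule abelian_groupI; simp)
    show "(\<lambda>x\<in>carrier M. (if x \<in> carrier M then f x + g x else undefined) + h x) =
        (\<lambda>x\<in>carrier M. f x + (if x \<in> carrier M then g x + h x else undefined))"
      for f g h :: "'m \<Rightarrow> qz" by (auto simp: add.assoc)
    show "(\<lambda>x\<in>carrier M. f x + g x) = (\<lambda>x\<in>carrier M. g x + f x)" for f g :: "'m \<Rightarrow> qz"
      by (auto simp: add.commute)
    show "(\<lambda>x\<in>carrier M. (if x \<in> carrier M then 0 else undefined) + f x) = f"
      if "f \<in> carrier (mod_dual M)" for f
      using that by (intro extensionalityI[of _ "carrier M"]) (auto simp: carrier_mod_dual)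
    show "\<exists>g\<in>carrier (mod_dual M). (\<lambda>x\<in>carrier M. g x + f x) = (\<lambda>x\<in>carrier M. 0)"
      if "f \<in> carrier (mod_dual M)" for f
      by (rule bexI[of _ "\<lambda>x\<in>carrier M. - f x"]) (use that in \<open>auto simp: carrier_mod_dual\<close>)
  qed (auto simp: carrier_mod_dual algebra_simps)
  then show ?thesis
    using M unfolding is_module_def
    by (cases s) (auto simp: carrier_mod_dual intro!: restrict_ext extensionalityI[of _ "carrier M"])
qed

lemma carrier_mod_dual_zero:
  assumes "abelian_group Z" "carrier Z = {\<zero>\<^bsub>Z\<^esub>}"
  shows "carrier (mod_dual Z) = {\<zero>\<^bsub>mod_dual Z\<^esub>}"
proof -
  interpret abelian_group Z by fact
  show ?thesis
    using character_zero[OF _ assms(1)] assms(2)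
    by (auto simp: carrier_mod_dual intro!: extensionalityI[of _ "{\<zero>\<^bsub>Z\<^esub>}"])
qed

text \<open>
  Injectivity of \<open>\<rat>/\<int>\<close>: a character of \<open>B\<close> that vanishes on the kernel of \<open>e\<close> lives on the image
  of \<open>e\<close>, and extends from there to the whole of \<open>C\<close>.
\<close>

lemma character_factors_through:
  assumes B: "abelian_group B" and C: "abelian_group C" and e: "e \<in> mod_hom R B C"
    and f: "f \<in> carrier (mod_dual B)" and kernel: "\<And>b. b \<in> carrier B \<Longrightarrow> e b = \<zero>\<^bsub>C\<^esub> \<Longrightarrow> f b = 0"
  obtains g where "g \<in> carrier (mod_dual C)" "\<And>b. b \<in> carrier B \<Longrightarrow> g (e b) = f b"
proof -
  interpret B: abelian_group B by fact
  interpret C: abelian_group C by fact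
  have fadd: "f (x \<oplus>\<^bsub>B\<^esub> y) = f x + f y" if "x \<in> carrier B" "y \<in> carrier B" for x y
    using f that by (simp add: carrier_mod_dual)
  have fminus: "f (\<ominus>\<^bsub>B\<^esub> x) = - f x" if "x \<in> carrier B" for x
    using fadd[of "\<ominus>\<^bsub>B\<^esub> x" x] that character_zero[OF f B] by (simp add: B.l_neg eq_neg_iff_add_eq_0)
  define G where "G = (\<lambda>b. (e b, f b)) ` carrier B"
  have GI: "(e b, f b) \<in> G" if "b \<in> carrier B" for b using that by (simp add: G_def)
  have "partial_character C G"
    unfolding partial_character_def
  proof (intro conjI allI impI)
    show "G \<subseteq> carrier C \<times> UNIV" using mod_hom_closed[OF e] by (auto simp: G_def)
    show "(\<zero>\<^bsub>C\<^esub>, 0) \<in> G"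
      using GI[OF B.zero_closed] mod_hom_zero[OF e B C] character_zero[OF f B] by simp
  next
    fix x u y v assume "(x, u) \<in> G" "(y, v) \<in> G"
    then show "(x \<oplus>\<^bsub>C\<^esub> y, u + v) \<in> G"
      using GI[OF B.a_closed] mod_hom_add[OF e] fadd by (fastforce simp: G_def)
  next
    fix x u assume "(x, u) \<in> G"
    then show "(\<ominus>\<^bsub>C\<^esub> x, - u) \<in> G"
      using GI[OF B.a_inv_closed] mod_hom_minus[OF e B C] fminus by (fastforce simp: G_def)
  next
    fix v assume "(\<zero>\<^bsub>C\<^esub>, v) \<in> G"
    then show "v = 0" using kernel by (auto simp: G_def)
  qed
  then obtain g where "g \<in> carrier (mod_dual C)" "\<And>x u. (x, u) \<in> G \<Longrightarrow> g x = u"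
    using partial_character_extends[OF C] by metis
  then show ?thesis using that GI by blast
qed

text \<open>
  \<open>\<rat>/\<int>\<close> is a cogenerator: a nonzero value at \<open>b\<close> is compatible with the zero character on the
  image of \<open>d\<close>.
\<close>

lemma character_separates:
  assumes A: "abelian_group A" and B: "abelian_group B" and d: "d \<in> mod_hom R A B"
    and b: "b \<in> carrier B" "b \<notin> d ` carrier A"
  obtains f where "f \<in> carrier (mod_dual B)" "\<And>a. a \<in> carrier A \<Longrightarrow> f (d a) = 0" "f b \<noteq> 0"
proof -
  interpret A: abelian_group A by fact
  interpret B: abelian_group B by fact
  define G where "G = (\<lambda>a. (d a, 0 :: qz)) ` carrier A"
  have GI: "(d a, 0) \<in> G" if "a \<in> carrier A" for a using that by (simp add: G_def)
  have "partial_character B G"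
    unfolding partial_character_def
  proof (intro conjI allI impI)
    show "G \<subseteq> carrier B \<times> UNIV" using mod_hom_closed[OF d] by (auto simp: G_def)
    show "(\<zero>\<^bsub>B\<^esub>, 0) \<in> G" using GI[OF A.zero_closed] mod_hom_zero[OF d A B] by simp
  next
    fix x u y v assume "(x, u) \<in> G" "(y, v) \<in> G"
    then show "(x \<oplus>\<^bsub>B\<^esub> y, u + v) \<in> G"
      using GI[OF A.a_closed] mod_hom_add[OF d] by (fastforce simp: G_def)
  next
    fix x u assume "(x, u) \<in> G"
    then show "(\<ominus>\<^bsub>B\<^esub> x, - u) \<in> G"
      using GI[OF A.a_inv_closed] mod_hom_minus[OF d A B] by (fastforce simp: G_def)
  qed (auto simp: G_def)
  moreover have "b \<notin> Domain G" using b(2) by (auto simp: G_def)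
  ultimately obtain H q where H: "partial_character B H" "G \<subseteq> H" "(b, q) \<in> H" "q \<noteq> 0"
    using partial_character_step[OF B _ b(1)] by metis
  obtain f where f: "f \<in> carrier (mod_dual B)" "\<And>x u. (x, u) \<in> H \<Longrightarrow> f x = u"
    using partial_character_extends[OF B H(1)] by metis
  show ?thesis
    by (rule that[OF f(1)]) (use f(2) H GI in blast)+
qed

text \<open>
  Both directions of the comparison of exactness at \<open>B\<close> with exactness at its dual: injectivity of
  \<open>\<rat>/\<int>\<close> dualises exact sequences, and the cogenerator property reflects exactness.
\<close>

lemma dual_exact_iff:
  assumes A: "abelian_group A" and B: "abelian_group B" and C: "abelian_group C"
    and d: "d \<in> mod_hom R A B" and e: "e \<in> mod_hom R B C"
    and ed: "\<And>a. a \<in> carrier A \<Longrightarrow> e (d a) = \<zero>\<^bsub>C\<^esub>"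
  shows "(\<forall>f\<in>carrier (mod_dual B). (\<forall>a\<in>carrier A. f (d a) = 0) \<longrightarrow>
            (\<exists>g\<in>carrier (mod_dual C). \<forall>b\<in>carrier B. f b = g (e b)))
     \<longleftrightarrow> {b \<in> carrier B. e b = \<zero>\<^bsub>C\<^esub>} = d ` carrier A" (is "?dual \<longleftrightarrow> ?exact")
proof
  assume dual: ?dual
  show ?exact
  proof (rule ccontr)
    assume "\<not> ?exact"
    moreover have "d ` carrier A \<subseteq> {b \<in> carrier B. e b = \<zero>\<^bsub>C\<^esub>}"
      using ed mod_hom_closed[OF d] by auto
    ultimately obtain b where b: "b \<in> carrier B" "e b = \<zero>\<^bsub>C\<^esub>" "b \<notin> d ` carrier A" by blast
    obtain f where f: "f \<in> carrier (mod_dual B)" "\<And>a. a \<in> carrier A \<Longrightarrow> f (d a) = 0" "f b \<noteq> 0"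
      using character_separates[OF A B d b(1,3)] by metis
    then obtain g where "g \<in> carrier (mod_dual C)" "f b = g (e b)" using dual b(1) by metis
    then show False using character_zero[OF _ C] b(2) f(3) by simp
  qed
next
  assume exact: ?exact
  show ?dual
  proof (intro ballI impI)
    fix f assume f: "f \<in> carrier (mod_dual B)" "\<forall>a\<in>carrier A. f (d a) = 0"
    have "f b = 0" if "b \<in> carrier B" "e b = \<zero>\<^bsub>C\<^esub>" for b
    proof -
      have "b \<in> d ` carrier A" using exact that by blast
      then show ?thesis using f(2) by blast
    qed
    then show "\<exists>g\<in>carrier (mod_dual C). \<forall>b\<in>carrier B. f b = g (e b)"
      using character_factors_through[OF B C e f(1)] by metis
  qed
qed


section \<open>Complexes, their cycles and exactness\<close>

lemma is_complex_obj: "is_complex s R X \<Longrightarrow> is_module s R (obj X n)"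
  by (simp add: is_complex_def)

lemma is_complex_obj_group: "is_complex s R X \<Longrightarrow> abelian_group (obj X n)"
  by (rule is_module_abelian_group) (rule is_complex_obj)

lemma is_complex_bdy: "is_complex s R X \<Longrightarrow> bdy X n \<in> mod_hom R (obj X n) (obj X (n - 1))"
  by (simp add: is_complex_def)

lemma is_complex_bdy_closed:
  "is_complex s R X \<Longrightarrow> x \<in> carrier (obj X n) \<Longrightarrow> bdy X n x \<in> carrier (obj X (n - 1))"
  using is_complex_bdy mod_hom_closed by fast

lemma is_complex_bdy_bdy:
  "is_complex s R X \<Longrightarrow> x \<in> carrier (obj X n) \<Longrightarrow> bdy X (n - 1) (bdy X n x) = \<zero>\<^bsub>obj X (n - 2)\<^esub>"
  by (simp add: is_complex_def)

lemma carrier_cycles: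
  "x \<in> carrier (cycles X n) \<longleftrightarrow> x \<in> carrier (obj X n) \<and> bdy X n x = \<zero>\<^bsub>obj X (n - 1)\<^esub>"
  by (simp add: cycles_def)

lemma cycles_simps [simp]:
  "\<zero>\<^bsub>cycles X n\<^esub> = \<zero>\<^bsub>obj X n\<^esub>"
  "x \<oplus>\<^bsub>cycles X n\<^esub> y = x \<oplus>\<^bsub>obj X n\<^esub> y"
  "a \<odot>\<^bsub>cycles X n\<^esub> x = a \<odot>\<^bsub>obj X n\<^esub> x"
  by (simp_all add: cycles_def)

lemma bdy_in_cycles:
  assumes "is_complex s R X" "x \<in> carrier (obj X (n + 1))"
  shows "bdy X (n + 1) x \<in> carrier (cycles X n)"
  using is_complex_bdy_closed[OF assms] is_complex_bdy_bdy[OF assms] by (simp add: carrier_cycles)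

lemma is_module_cycles:
  assumes X: "is_complex s R X"
  shows "is_module s R (cycles X n)"
proof -
  let ?d = "bdy X n" and ?M = "obj X n" and ?N = "obj X (n - 1)"
  interpret M: abelian_group ?M using X by (rule is_complex_obj_group)
  interpret N: abelian_group ?N using X by (rule is_complex_obj_group)
  note d = is_complex_bdy[OF X, of n]
  show ?thesis
    unfolding cycles_def
    by (rule is_module_submodule_on[OF is_complex_obj[OF X]])
      (auto simp: mod_hom_zero[OF d M.abelian_group_axioms N.abelian_group_axioms]
        mod_hom_add[OF d] mod_hom_smult[OF d] is_module_smult_zero[OF is_complex_obj[OF X]]
        mod_hom_minus[OF d M.abelian_group_axioms N.abelian_group_axioms]
        is_module_smult_closed[OF is_complex_obj[OF X]])
qed

lemma exact_complex_iff:
  assumes "is_complex s R X"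
  shows "exact_complex X \<longleftrightarrow>
    (\<forall>n. \<forall>x\<in>carrier (cycles X n). \<exists>y\<in>carrier (obj X (n + 1)). bdy X (n + 1) y = x)"
  unfolding exact_complex_def
proof (rule all_cong1)
  fix n
  have "bdy X (n + 1) ` carrier (obj X (n + 1)) \<subseteq> carrier (cycles X n)"
    using bdy_in_cycles[OF assms] by blast
  then show "carrier (cycles X n) = bdy X (n + 1) ` carrier (obj X (n + 1)) \<longleftrightarrow>
      (\<forall>x\<in>carrier (cycles X n). \<exists>y\<in>carrier (obj X (n + 1)). bdy X (n + 1) y = x)"
    by auto
qed

lemma exact_complex_preimage:
  assumes "exact_complex X" "x \<in> carrier (cycles X n)"
  shows "\<exists>y\<in>carrier (obj X (n + 1)). bdy X (n + 1) y = x"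
proof -
  have "carrier (cycles X n) = bdy X (n + 1) ` carrier (obj X (n + 1))"
    using assms(1) by (simp add: exact_complex_def)
  then have "x \<in> bdy X (n + 1) ` carrier (obj X (n + 1))" using assms(2) by simp
  then show ?thesis by blast
qed

lemma exact_complexE:
  assumes "exact_complex X" "x \<in> carrier (obj X n)" "bdy X n x = \<zero>\<^bsub>obj X (n - 1)\<^esub>"
  obtains y where "y \<in> carrier (obj X (n + 1))" "bdy X (n + 1) y = x"
  using exact_complex_preimage[OF assms(1), of x n] assms(2,3) that by (auto simp: carrier_cycles)

text \<open>
  The three constructions of a class of complexes from a class \<open>\<M>\<close> of modules all have the same
  shape: certain modules attached to the complex have to lie in \<open>\<M>\<close>, and the complex may have
  to be exact.
\<close>

datatype cx_kind = Degreewise | DegreewiseExact | Cyclewise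

definition piece :: "cx_kind \<Rightarrow> ('r, 'm) mod_complex \<Rightarrow> int \<Rightarrow> ('r, 'm) module" where
  "piece \<kappa> X n = (if \<kappa> = Cyclewise then cycles X n else obj X n)"

definition admissible :: "cx_kind \<Rightarrow> ('r, 'm) mod_complex \<Rightarrow> bool" where
  "admissible \<kappa> X \<longleftrightarrow> \<kappa> = Degreewise \<or> exact_complex X"

definition kind_class ::
  "cx_kind \<Rightarrow> side \<Rightarrow> ('r, 'k) ring_scheme \<Rightarrow> ('r, 'm) module set \<Rightarrow> ('r, 'm) mod_complex set" where
  "kind_class \<kappa> s R \<M> = {X. is_complex s R X \<and> admissible \<kappa> X \<and> (\<forall>n. piece \<kappa> X n \<in> \<M>)}"

lemma kind_class_iff:
  "X \<in> kind_class \<kappa> s R \<M> \<longleftrightarrow> is_complex s R X \<and> admissible \<kappa> X \<and> (\<forall>n. piece \<kappa> X n \<in> \<M>)"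
  by (simp add: kind_class_def)

lemma kind_class_simps:
  "kind_class Degreewise s R \<M> = dw_class s R \<M>"
  "kind_class DegreewiseExact s R \<M> = ex_class s R \<M>"
  "kind_class Cyclewise s R \<M> = tilde_class s R \<M>"
  by (auto simp: kind_class_def dw_class_def ex_class_def tilde_class_def piece_def admissible_def)

lemma is_module_piece: "is_complex s R X \<Longrightarrow> is_module s R (piece \<kappa> X n)"
  by (simp add: piece_def is_complex_obj is_module_cycles)


section \<open>Isomorphic complexes\<close>

lemma chain_map_hom: "f \<in> chain_map R X Y \<Longrightarrow> f n \<in> mod_hom R (obj X n) (obj Y n)"
  by (simp add: chain_map_def)

lemma chain_map_bdy:
  "f \<in> chain_map R X Y \<Longrightarrow> x \<in> carrier (obj X n) \<Longrightarrow> f (n - 1) (bdy X n x) = bdy Y n (f n x)"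
  by (simp add: chain_map_def)

lemma chain_map_bdy_Suc:
  "f \<in> chain_map R X Y \<Longrightarrow> x \<in> carrier (obj X (n + 1)) \<Longrightarrow>
    f n (bdy X (n + 1) x) = bdy Y (n + 1) (f (n + 1) x)"
  using chain_map_bdy[of f R X Y x "n + 1"] by simp

lemma chain_map_zero:
  "f \<in> chain_map R X Y \<Longrightarrow> is_complex s R X \<Longrightarrow> is_complex s R Y \<Longrightarrow>
    f n \<zero>\<^bsub>obj X n\<^esub> = \<zero>\<^bsub>obj Y n\<^esub>"
  by (rule mod_hom_zero[OF chain_map_hom is_complex_obj_group is_complex_obj_group])

lemma chain_map_closed:
  "f \<in> chain_map R X Y \<Longrightarrow> x \<in> carrier (obj X n) \<Longrightarrow> f n x \<in> carrier (obj Y n)"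
  by (rule mod_hom_closed[OF chain_map_hom])

lemma chain_map_cycles:
  assumes f: "f \<in> chain_map R X Y" and X: "is_complex s R X" and Y: "is_complex s R Y"
    and x: "x \<in> carrier (cycles X n)"
  shows "f n x \<in> carrier (cycles Y n)"
  using x chain_map_bdy[OF f, of x n] chain_map_zero[OF f X Y] chain_map_closed[OF f]
  by (simp add: carrier_cycles)

lemma chain_map_cycles_hom:
  assumes f: "f \<in> chain_map R X Y" and X: "is_complex s R X" and Y: "is_complex s R Y"
  shows "f n \<in> mod_hom R (cycles X n) (cycles Y n)"
  using chain_map_cycles[OF assms] chain_map_hom[OF f, of n]
  by (auto simp: mod_hom_def carrier_cycles)

text \<open>Injectivity in the next lower degree makes the preimage of a cycle a cycle.\<close>

lemma chain_map_reflects_cycles: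
  assumes f: "f \<in> chain_map R X Y" and X: "is_complex s R X" and Y: "is_complex s R Y"
    and inj: "inj_on (f (n - 1)) (carrier (obj X (n - 1)))"
    and x: "x \<in> carrier (obj X n)" "f n x \<in> carrier (cycles Y n)"
  shows "x \<in> carrier (cycles X n)"
proof -
  have "f (n - 1) (bdy X n x) = f (n - 1) \<zero>\<^bsub>obj X (n - 1)\<^esub>"
    using chain_map_bdy[OF f x(1)] chain_map_zero[OF f X Y] x(2) by (simp add: carrier_cycles)
  then have "bdy X n x = \<zero>\<^bsub>obj X (n - 1)\<^esub>"
    using inj is_complex_bdy_closed[OF X x(1)] is_module_zero_closed[OF is_complex_obj[OF X]]
    by (auto dest: inj_onD)
  then show ?thesis using x(1) by (simp add: carrier_cycles)
qed

lemma cx_isomorphic_cycles_image: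
  assumes f: "f \<in> chain_map R X Y" and X: "is_complex s R X" and Y: "is_complex s R Y"
    and bij: "\<And>n. bij_betw (f n) (carrier (obj X n)) (carrier (obj Y n))"
  shows "f n ` carrier (cycles X n) = carrier (cycles Y n)"
proof
  show "f n ` carrier (cycles X n) \<subseteq> carrier (cycles Y n)" using chain_map_cycles[OF f X Y] by blast
  show "carrier (cycles Y n) \<subseteq> f n ` carrier (cycles X n)"
  proof
    fix y assume y: "y \<in> carrier (cycles Y n)"
    then have "y \<in> f n ` carrier (obj X n)"
      using bij[of n] by (simp add: bij_betw_def carrier_cycles)
    then obtain x where x: "x \<in> carrier (obj X n)" "f n x = y" by blast
    then show "y \<in> f n ` carrier (cycles X n)"
      using chain_map_reflects_cycles[OF f X Y bij_betw_imp_inj_on[OF bij] x(1)] y by blast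
  qed
qed

lemma cx_isomorphic_piece:
  assumes iso: "cx_isomorphic R X Y" and X: "is_complex s R X" and Y: "is_complex s R Y"
  shows "mod_isomorphic R (piece \<kappa> X n) (piece \<kappa> Y n)"
proof -
  obtain f where f: "f \<in> chain_map R X Y"
    and bij: "\<And>n. bij_betw (f n) (carrier (obj X n)) (carrier (obj Y n))"
    using iso by (auto simp: cx_isomorphic_def)
  have "carrier (cycles X n) \<subseteq> carrier (obj X n)" by (auto simp: carrier_cycles)
  then have "bij_betw (f n) (carrier (cycles X n)) (carrier (cycles Y n))"
    using cx_isomorphic_cycles_image[OF f X Y bij, of n] bij[of n] bij_betw_subset by metis
  then show ?thesis
    using chain_map_hom[OF f] chain_map_cycles_hom[OF f X Y] bij
    by (auto simp: mod_isomorphic_def piece_def)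
qed

lemma cx_isomorphic_exact:
  assumes iso: "cx_isomorphic R X Y" and X: "is_complex s R X" and Y: "is_complex s R Y"
  shows "exact_complex X \<longleftrightarrow> exact_complex Y"
proof -
  obtain f where f: "f \<in> chain_map R X Y"
    and bij: "\<And>n. bij_betw (f n) (carrier (obj X n)) (carrier (obj Y n))"
    using iso by (auto simp: cx_isomorphic_def)
  have "carrier (cycles X n) = bdy X (n + 1) ` carrier (obj X (n + 1)) \<longleftrightarrow>
      carrier (cycles Y n) = bdy Y (n + 1) ` carrier (obj Y (n + 1))" for n
  proof -
    have "f n ` bdy X (n + 1) ` carrier (obj X (n + 1)) =
        bdy Y (n + 1) ` f (n + 1) ` carrier (obj X (n + 1))"
      unfolding image_image using chain_map_bdy_Suc[OF f] by (intro image_cong) auto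
    then have boundaries: "f n ` bdy X (n + 1) ` carrier (obj X (n + 1)) =
        bdy Y (n + 1) ` carrier (obj Y (n + 1))"
      using bij[of "n + 1"] by (simp add: bij_betw_def)
    have sub: "carrier (cycles X n) \<subseteq> carrier (obj X n)"
      "bdy X (n + 1) ` carrier (obj X (n + 1)) \<subseteq> carrier (obj X n)"
      using bdy_in_cycles[OF X] by (auto simp: carrier_cycles)
    show ?thesis
      using inj_on_image_eq_iff[OF bij_betw_imp_inj_on[OF bij] sub]
      unfolding boundaries cx_isomorphic_cycles_image[OF f X Y bij] by (rule sym)
  qed
  then show ?thesis unfolding exact_complex_def by (rule all_cong1)
qed

lemma cx_isomorphic_admissible:
  "cx_isomorphic R X Y \<Longrightarrow> is_complex s R X \<Longrightarrow> is_complex s R Y \<Longrightarrow>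
    admissible \<kappa> X \<longleftrightarrow> admissible \<kappa> Y"
  using cx_isomorphic_exact unfolding admissible_def by blast


section \<open>Pontrjagin duals of complexes\<close>

text \<open>
  Every degree \<open>n\<close> of the dual is written as \<open>- k - 2\<close> below, where \<open>k\<close> is the degree that is
  dualised; this keeps the arithmetic of indices away from the argument.
\<close>

lemma obj_cx_dual: "obj (cx_dual X) (- k - 2) = mod_dual (obj X k)"
  by (simp add: cx_dual_def)

lemma bdy_cx_dual:
  "bdy (cx_dual X) (- k - 2) f =
     (\<lambda>x\<in>carrier (obj X (k + 1)).
       if even k then f (bdy X (k + 1) x) else - f (bdy X (k + 1) x))"
proof -
  have "- (- k - 2) - 1 = k + 1" by simp
  then show ?thesis by (simp add: cx_dual_def restrict_def add.commute cong: if_cong)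
qed

lemma dual_degree_cases: obtains k :: int where "n = - k - 2"
  using that[of "- n - 2"] by simp

lemma dual_degree_pred: "- k - 2 - 1 = - (k + 1) - (2 :: int)"
  by simp

lemma dual_degree_succ: "- k - 2 + 1 = - (k - 1) - (2 :: int)"
  by simp

lemma is_complex_cx_dual:
  assumes X: "is_complex s R X"
  shows "is_complex (opposite s) R (cx_dual X)"
proof -
  have hom: "bdy (cx_dual X) (- k - 2) \<in> mod_hom R (mod_dual (obj X k)) (mod_dual (obj X (k + 1)))"
    for k
  proof -
    let ?d = "bdy X (k + 1)"
    have d: "?d \<in> mod_hom R (obj X (k + 1)) (obj X k)" using is_complex_bdy[OF X, of "k + 1"] by simp
    show ?thesis
      unfolding mod_hom_def
    proof (intro CollectI conjI ballI Pi_I)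
      fix f assume f: "f \<in> carrier (mod_dual (obj X k))"
      then show "bdy (cx_dual X) (- k - 2) f \<in> carrier (mod_dual (obj X (k + 1)))"
        using mod_hom_closed[OF d] mod_hom_add[OF d] is_module_add_closed[OF is_complex_obj[OF X]]
        by (auto simp: carrier_mod_dual bdy_cx_dual)
      show "bdy (cx_dual X) (- k - 2) (a \<odot>\<^bsub>mod_dual (obj X k)\<^esub> f) =
          a \<odot>\<^bsub>mod_dual (obj X (k + 1))\<^esub> bdy (cx_dual X) (- k - 2) f" if "a \<in> carrier R" for a
        using that mod_hom_closed[OF d] mod_hom_smult[OF d]
          is_module_smult_closed[OF is_complex_obj[OF X]]
        by (auto simp: bdy_cx_dual)
      fix g assume "g \<in> carrier (mod_dual (obj X k))"
      show "bdy (cx_dual X) (- k - 2) (f \<oplus>\<^bsub>mod_dual (obj X k)\<^esub> g) =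
          bdy (cx_dual X) (- k - 2) f \<oplus>\<^bsub>mod_dual (obj X (k + 1))\<^esub> bdy (cx_dual X) (- k - 2) g"
        using mod_hom_closed[OF d] by (auto simp: bdy_cx_dual)
    qed
  qed
  have square: "bdy (cx_dual X) (- (k + 1) - 2) (bdy (cx_dual X) (- k - 2) f) =
      \<zero>\<^bsub>mod_dual (obj X (k + 2))\<^esub>" if f: "f \<in> carrier (mod_dual (obj X k))" for k f
  proof -
    have "bdy X (k + 2) x \<in> carrier (obj X (k + 1))"
      "f (bdy X (k + 1) (bdy X (k + 2) x)) = 0" if "x \<in> carrier (obj X (k + 2))" for x
      using is_complex_bdy_closed[OF X that] is_complex_bdy_bdy[OF X that]
        character_zero[OF f is_complex_obj_group[OF X]] by (simp_all add: add.commute)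
    moreover have k2: "k + 1 + 1 = k + 2" by simp
    ultimately show ?thesis unfolding bdy_cx_dual k2 by auto
  qed
  show ?thesis
    unfolding is_complex_def
  proof (intro conjI allI ballI)
    fix n :: int
    obtain k where n: "n = - k - 2" by (rule dual_degree_cases)
    have n1: "obj (cx_dual X) (n - 1) = mod_dual (obj X (k + 1))"
      unfolding n dual_degree_pred by (rule obj_cx_dual)
    have n2: "obj (cx_dual X) (n - 2) = mod_dual (obj X (k + 2))"
      using obj_cx_dual[of X "k + 2"] by (simp add: n)
    show "is_module (opposite s) R (obj (cx_dual X) n)"
      unfolding n obj_cx_dual by (rule is_module_mod_dual[OF is_complex_obj[OF X]])
    show "bdy (cx_dual X) n \<in> mod_hom R (obj (cx_dual X) n) (obj (cx_dual X) (n - 1))"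
      unfolding n1 unfolding n obj_cx_dual by (rule hom)
    fix f assume "f \<in> carrier (obj (cx_dual X) n)"
    then show "bdy (cx_dual X) (n - 1) (bdy (cx_dual X) n f) = \<zero>\<^bsub>obj (cx_dual X) (n - 2)\<^esub>"
      unfolding n2 unfolding n obj_cx_dual dual_degree_pred by (rule square)
  qed
qed

lemma carrier_cycles_cx_dual:
  "f \<in> carrier (cycles (cx_dual X) (- k - 2)) \<longleftrightarrow>
     f \<in> carrier (mod_dual (obj X k)) \<and> (\<forall>x\<in>carrier (obj X (k + 1)). f (bdy X (k + 1) x) = 0)"
  unfolding carrier_cycles dual_degree_pred obj_cx_dual bdy_cx_dual
  by (auto simp: fun_eq_iff restrict_def)

lemma character_uminus:
  "g \<in> carrier (mod_dual M) \<Longrightarrow> abelian_group M \<Longrightarrow>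
     (\<lambda>x\<in>carrier M. - g x) \<in> carrier (mod_dual M)"
  by (auto simp: carrier_mod_dual abelian_group_def abelian_monoid.a_closed)

text \<open>The sign in the differential of the dual does not affect its image.\<close>

lemma boundaries_cx_dual:
  assumes X: "is_complex s R X" and f: "f \<in> carrier (mod_dual (obj X k))"
  shows "f \<in> bdy (cx_dual X) (- (k - 1) - 2) ` carrier (mod_dual (obj X (k - 1))) \<longleftrightarrow>
    (\<exists>g\<in>carrier (mod_dual (obj X (k - 1))). \<forall>x\<in>carrier (obj X k). f x = g (bdy X k x))"
    (is "?L \<longleftrightarrow> ?R")
proof
  note uminus = character_uminus[OF _ is_complex_obj_group[OF X]]
  note closed = is_complex_bdy_closed[OF X]
  have bdy: "bdy (cx_dual X) (- (k - 1) - 2) g =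
      (\<lambda>x\<in>carrier (obj X k). if odd k then g (bdy X k x) else - g (bdy X k x))" for g
    unfolding bdy_cx_dual by (simp cong: if_cong)
  {
    assume ?L
    then obtain g where g: "g \<in> carrier (mod_dual (obj X (k - 1)))"
      "f = bdy (cx_dual X) (- (k - 1) - 2) g" by blast
    show ?R
    proof (rule bexI)
      let ?h = "if odd k then g else (\<lambda>x\<in>carrier (obj X (k - 1)). - g x)"
      show "?h \<in> carrier (mod_dual (obj X (k - 1)))" using g(1) uminus[OF g(1)] by simp
      show "\<forall>x\<in>carrier (obj X k). f x = ?h (bdy X k x)" using closed unfolding g(2) bdy by simp
    qed
  next
    assume ?R
    then obtain g where g: "g \<in> carrier (mod_dual (obj X (k - 1)))"
      "\<And>x. x \<in> carrier (obj X k) \<Longrightarrow> f x = g (bdy X k x)" by blast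
    define h where "h = (if odd k then g else (\<lambda>x\<in>carrier (obj X (k - 1)). - g x))"
    have "h \<in> carrier (mod_dual (obj X (k - 1)))" using g(1) uminus[OF g(1)] by (simp add: h_def)
    moreover have "f = bdy (cx_dual X) (- (k - 1) - 2) h"
      unfolding bdy using f g(2) closed
      by (intro extensionalityI[of _ "carrier (obj X k)"]) (auto simp: carrier_mod_dual h_def)
    ultimately show ?L by blast
  }
qed

lemma exact_cx_dual:
  assumes X: "is_complex s R X"
  shows "exact_complex (cx_dual X) \<longleftrightarrow> exact_complex X"
proof -
  let ?D = "cx_dual X"
  have at: "carrier (cycles ?D (- k - 2)) = bdy ?D (- k - 2 + 1) ` carrier (obj ?D (- k - 2 + 1))
      \<longleftrightarrow> carrier (cycles X k) = bdy X (k + 1) ` carrier (obj X (k + 1))" for k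
  proof -
    have "carrier (cycles ?D (- k - 2)) = bdy ?D (- k - 2 + 1) ` carrier (obj ?D (- k - 2 + 1))
      \<longleftrightarrow> (\<forall>f\<in>carrier (cycles ?D (- k - 2)).
            f \<in> bdy ?D (- k - 2 + 1) ` carrier (obj ?D (- k - 2 + 1)))"
      using bdy_in_cycles[OF is_complex_cx_dual[OF X], of _ "- k - 2"] by blast
    also have "\<dots> \<longleftrightarrow> (\<forall>f\<in>carrier (mod_dual (obj X k)).
        (\<forall>x\<in>carrier (obj X (k + 1)). f (bdy X (k + 1) x) = 0) \<longrightarrow>
        (\<exists>g\<in>carrier (mod_dual (obj X (k - 1))). \<forall>x\<in>carrier (obj X k). f x = g (bdy X k x)))"
      using boundaries_cx_dual[OF X]
      unfolding dual_degree_succ obj_cx_dual carrier_cycles_cx_dual Ball_def by blast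
    also have "\<dots> \<longleftrightarrow> {x \<in> carrier (obj X k). bdy X k x = \<zero>\<^bsub>obj X (k - 1)\<^esub>} =
        bdy X (k + 1) ` carrier (obj X (k + 1))"
      using is_complex_bdy[OF X, of "k + 1"] is_complex_bdy_bdy[OF X, of _ "k + 1"]
      by (intro dual_exact_iff[where R = R] is_complex_obj_group[OF X] is_complex_bdy[OF X]) simp_all
    finally show ?thesis by (simp add: cycles_def)
  qed
  have "(\<forall>n. P n) \<longleftrightarrow> (\<forall>k. P (- k - 2))" for P :: "int \<Rightarrow> bool"
    using dual_degree_cases by metis
  then have "exact_complex ?D \<longleftrightarrow> (\<forall>k. carrier (cycles ?D (- k - 2)) =
      bdy ?D (- k - 2 + 1) ` carrier (obj ?D (- k - 2 + 1)))"
    unfolding exact_complex_def .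
  also have "\<dots> \<longleftrightarrow> exact_complex X"
    unfolding exact_complex_def by (rule all_cong1) (rule at)
  finally show ?thesis .
qed

text \<open>
  A cycle of the dual is a character of \<open>X\<^sub>k\<close> that vanishes on the boundaries, which are the kernel
  of \<open>X\<^sub>k \<rightarrow> Z\<^sub>k\<^sub>-\<^sub>1\<close> by exactness in degree \<open>k\<close>. By exactness in degree \<open>k - 1\<close> this map is onto, so
  composition with it identifies these characters with those of \<open>Z\<^sub>k\<^sub>-\<^sub>1\<close>.
\<close>

lemma dual_cycles_isomorphic:
  assumes X: "is_complex s R X" and exact: "exact_complex X"
  shows "mod_isomorphic R (mod_dual (cycles X (k - 1))) (cycles (cx_dual X) (- k - 2))"
proof -
  let ?d = "bdy X k" and ?B = "obj X k" and ?Z = "cycles X (k - 1)"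
  let ?\<phi> = "\<lambda>g. \<lambda>x\<in>carrier ?B. g (?d x)"
  have dZ: "?d x \<in> carrier ?Z" if "x \<in> carrier ?B" for x
    using bdy_in_cycles[OF X, of x "k - 1"] that by simp
  have d: "?d \<in> mod_hom R ?B ?Z"
    using is_complex_bdy[OF X, of k] dZ by (auto simp: mod_hom_def)
  have dd: "?d (bdy X (k + 1) x) = \<zero>\<^bsub>?Z\<^esub>" if "x \<in> carrier (obj X (k + 1))" for x
    using bdy_in_cycles[OF X that] by (simp add: carrier_cycles)
  have onto: "\<exists>x\<in>carrier ?B. ?d x = z" if "z \<in> carrier ?Z" for z
    using exact that unfolding exact_complex_iff[OF X] by (metis diff_add_cancel)
  have groups: "abelian_group ?B" "abelian_group ?Z"
    using is_complex_obj_group[OF X] is_module_abelian_group[OF is_module_cycles[OF X]] by auto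
  have B_closed: "x \<oplus>\<^bsub>?B\<^esub> y \<in> carrier ?B" if "x \<in> carrier ?B" "y \<in> carrier ?B" for x y
    using is_module_add_closed[OF is_complex_obj[OF X]] that .
  have in_cycles: "?\<phi> g \<in> carrier (cycles (cx_dual X) (- k - 2))"
    if g: "g \<in> carrier (mod_dual ?Z)" for g
  proof -
    have "bdy X (k + 1) x \<in> carrier ?B" if "x \<in> carrier (obj X (k + 1))" for x
      using is_complex_bdy_closed[OF X that] by simp
    then show ?thesis
      unfolding carrier_cycles_cx_dual
      using g mod_hom_add[OF d] dZ dd character_zero[OF g groups(2)] B_closed
      by (auto simp: carrier_mod_dual)
  qed
  have cycles_ops: "f \<oplus>\<^bsub>cycles (cx_dual X) (- k - 2)\<^esub> g = f \<oplus>\<^bsub>mod_dual ?B\<^esub> g"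
    "a \<odot>\<^bsub>cycles (cx_dual X) (- k - 2)\<^esub> f = a \<odot>\<^bsub>mod_dual ?B\<^esub> f" for a f g
    unfolding cycles_simps obj_cx_dual by (rule refl)+
  have "?\<phi> \<in> mod_hom R (mod_dual ?Z) (cycles (cx_dual X) (- k - 2))"
    unfolding mod_hom_def
  proof (intro CollectI conjI ballI Pi_I in_cycles)
    fix f g assume "f \<in> carrier (mod_dual ?Z)" "g \<in> carrier (mod_dual ?Z)"
    show "?\<phi> (f \<oplus>\<^bsub>mod_dual ?Z\<^esub> g) = ?\<phi> f \<oplus>\<^bsub>cycles (cx_dual X) (- k - 2)\<^esub> ?\<phi> g"
      using dZ unfolding cycles_ops by auto
  next
    fix a f assume a: "a \<in> carrier R" "f \<in> carrier (mod_dual ?Z)"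
    show "?\<phi> (a \<odot>\<^bsub>mod_dual ?Z\<^esub> f) = a \<odot>\<^bsub>cycles (cx_dual X) (- k - 2)\<^esub> ?\<phi> f"
      using dZ mod_hom_smult[OF d a(1)] is_module_smult_closed[OF is_complex_obj[OF X] a(1)]
      unfolding cycles_ops by auto
  qed
  moreover have "bij_betw ?\<phi> (carrier (mod_dual ?Z)) (carrier (cycles (cx_dual X) (- k - 2)))"
    unfolding bij_betw_def
  proof
    show "inj_on ?\<phi> (carrier (mod_dual ?Z))"
    proof (rule inj_onI)
      fix f g assume fg: "f \<in> carrier (mod_dual ?Z)" "g \<in> carrier (mod_dual ?Z)" "?\<phi> f = ?\<phi> g"
      have "f z = g z" if z: "z \<in> carrier ?Z" for z
      proof -
        obtain x where x: "x \<in> carrier ?B" "?d x = z" using onto[OF z] by metis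
        have "?\<phi> f x = ?\<phi> g x" using fg(3) by (rule fun_cong)
        then show ?thesis using x by simp
      qed
      then show "f = g"
        using fg by (intro extensionalityI[of _ "carrier ?Z"]) (auto simp: carrier_mod_dual)
    qed
    show "?\<phi> ` carrier (mod_dual ?Z) = carrier (cycles (cx_dual X) (- k - 2))"
    proof
      show "carrier (cycles (cx_dual X) (- k - 2)) \<subseteq> ?\<phi> ` carrier (mod_dual ?Z)"
      proof
        fix f assume "f \<in> carrier (cycles (cx_dual X) (- k - 2))"
        then have f: "f \<in> carrier (mod_dual ?B)"
          "\<And>x. x \<in> carrier (obj X (k + 1)) \<Longrightarrow> f (bdy X (k + 1) x) = 0"
          by (auto simp: carrier_cycles_cx_dual)
        have "f b = 0" if b: "b \<in> carrier ?B" "?d b = \<zero>\<^bsub>?Z\<^esub>" for b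
          using exact_complexE[OF exact b(1)] b(2) f(2) by (metis cycles_simps(1))
        then obtain g where g: "g \<in> carrier (mod_dual ?Z)"
          "\<And>b. b \<in> carrier ?B \<Longrightarrow> g (?d b) = f b"
          using character_factors_through[OF groups d f(1)] by metis
        have "f = ?\<phi> g"
          using f(1) g(2)
          by (intro extensionalityI[of _ "carrier ?B"]) (auto simp: carrier_mod_dual)
        then show "f \<in> ?\<phi> ` carrier (mod_dual ?Z)" using g(1) by blast
      qed
    qed (use in_cycles in blast)
  qed
  ultimately show ?thesis by (auto simp: mod_isomorphic_def)
qed

text \<open>
  Thus the pieces of the dual are the duals of the pieces: literally for the terms of a complex, up
  to isomorphism for the cycles. Closure under isomorphism absorbs the difference.
\<close>

lemma cx_dual_in_kind_class:
  assumes X: "is_complex s R X" and closed: "mod_summand_closed (opposite s) R \<C>"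
  shows "cx_dual X \<in> kind_class \<kappa> (opposite s) R \<C> \<longleftrightarrow>
    admissible \<kappa> X \<and> (\<forall>n. mod_dual (piece \<kappa> X n) \<in> \<C>)"
proof -
  note D = is_complex_cx_dual[OF X]
  have adm: "admissible \<kappa> (cx_dual X) \<longleftrightarrow> admissible \<kappa> X"
    using exact_cx_dual[OF X] by (simp add: admissible_def)
  have "(\<forall>n. piece \<kappa> (cx_dual X) n \<in> \<C>) \<longleftrightarrow> (\<forall>n. mod_dual (piece \<kappa> X n) \<in> \<C>)"
    if "admissible \<kappa> X"
  proof (cases "\<kappa> = Cyclewise")
    case False
    have "(\<forall>n. obj (cx_dual X) n \<in> \<C>) \<longleftrightarrow> (\<forall>k. obj (cx_dual X) (- k - 2) \<in> \<C>)"
      using dual_degree_cases by metis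
    then show ?thesis using False by (simp add: piece_def obj_cx_dual)
  next
    case True
    then have exact: "exact_complex X" using that by (auto simp: admissible_def)
    have iso: "mod_isomorphic R (mod_dual (cycles X k)) (cycles (cx_dual X) (- k - 3))" for k
    proof -
      have "- (k + 1) - 2 = - k - (3 :: int)" "k + 1 - 1 = k" by simp_all
      then show ?thesis using dual_cycles_isomorphic[OF X exact, of "k + 1"] by metis
    qed
    have "mod_dual (cycles X k) \<in> \<C> \<longleftrightarrow> cycles (cx_dual X) (- k - 3) \<in> \<C>" for k
      using mod_summand_closed_isomorphic[OF closed] iso[of k]
        mod_isomorphic_sym[OF is_module_mod_dual[OF is_module_cycles[OF X]] iso[of k]]
        is_module_mod_dual[OF is_module_cycles[OF X], of k] is_module_cycles[OF D] by metis
    moreover have "\<exists>k. n = - k - 3" for n :: int by (rule exI[of _ "- n - 3"]) simp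
    ultimately show ?thesis using True by (simp add: piece_def) metis
  qed
  then show ?thesis using D adm by (auto simp: kind_class_iff)
qed


section \<open>Products and coproducts of complexes\<close>

definition cx_rprod ::
  "bool \<Rightarrow> 'i set \<Rightarrow> ('i \<Rightarrow> ('r, 'm) mod_complex) \<Rightarrow> ('r, 'i \<Rightarrow> 'm) mod_complex" where
  "cx_rprod fin I X =
     \<lparr>obj = (\<lambda>n. mod_rprod fin I (\<lambda>i. obj (X i) n)),
      bdy = (\<lambda>n x. \<lambda>i\<in>I. bdy (X i) n (x i))\<rparr>"

lemma cx_product_eq_rprod: "cx_product I X = cx_rprod False I X"
  by (simp add: cx_product_def cx_rprod_def mod_product_eq_rprod)

lemma cx_coproduct_eq_rprod: "cx_coproduct I X = cx_rprod True I X"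
  by (simp add: cx_coproduct_def cx_rprod_def mod_coproduct_eq_rprod)

lemma obj_cx_rprod [simp]: "obj (cx_rprod fin I X) n = mod_rprod fin I (\<lambda>i. obj (X i) n)"
  by (simp add: cx_rprod_def)

lemma bdy_cx_rprod [simp]: "bdy (cx_rprod fin I X) n x = (\<lambda>i\<in>I. bdy (X i) n (x i))"
  by (simp add: cx_rprod_def)

lemma restrict_eq_restrict_iff: "restrict f I = restrict g I \<longleftrightarrow> (\<forall>i\<in>I. f i = g i)"
  by (metis restrict_apply' restrict_ext)

lemma is_complex_cx_rprod:
  assumes X: "\<And>i. i \<in> I \<Longrightarrow> is_complex s R (X i)"
  shows "is_complex s R (cx_rprod fin I X)"
proof -
  have bdy_zero: "bdy (X i) n \<zero>\<^bsub>obj (X i) n\<^esub> = \<zero>\<^bsub>obj (X i) (n - 1)\<^esub>" if "i \<in> I" for i n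
    using mod_hom_zero[OF is_complex_bdy[OF X[OF that]]
        is_complex_obj_group[OF X[OF that]] is_complex_obj_group[OF X[OF that]]] .
  show ?thesis
    unfolding is_complex_def
  proof (intro conjI allI ballI)
    fix n
    show "is_module s R (obj (cx_rprod fin I X) n)"
      using X by (auto intro!: is_module_mod_rprod is_complex_obj)
    show "bdy (cx_rprod fin I X) n \<in>
        mod_hom R (obj (cx_rprod fin I X) n) (obj (cx_rprod fin I X) (n - 1))"
      unfolding mod_hom_def
    proof (intro CollectI conjI ballI Pi_I)
      fix x assume x: "x \<in> carrier (obj (cx_rprod fin I X) n)"
      then have xi: "x i \<in> carrier (obj (X i) n)" if "i \<in> I" for i
        using that by (simp add: carrier_mod_rprod)
      show "bdy (cx_rprod fin I X) n x \<in> carrier (obj (cx_rprod fin I X) (n - 1))"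
        using x is_complex_bdy_closed[OF X xi] bdy_zero unfolding obj_cx_rprod bdy_cx_rprod
        by (auto intro!: carrier_mod_rprod_pointwise[of x fin I "\<lambda>i. obj (X i) n" x])
      show "bdy (cx_rprod fin I X) n (a \<odot>\<^bsub>obj (cx_rprod fin I X) n\<^esub> x) =
          a \<odot>\<^bsub>obj (cx_rprod fin I X) (n - 1)\<^esub> bdy (cx_rprod fin I X) n x"
        if "a \<in> carrier R" for a
        using mod_hom_smult[OF is_complex_bdy[OF X] that xi] by (auto simp: restrict_eq_restrict_iff)
      fix y assume "y \<in> carrier (obj (cx_rprod fin I X) n)"
      then have yi: "y i \<in> carrier (obj (X i) n)" if "i \<in> I" for i
        using that by (simp add: carrier_mod_rprod)
      show "bdy (cx_rprod fin I X) n (x \<oplus>\<^bsub>obj (cx_rprod fin I X) n\<^esub> y) =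
          bdy (cx_rprod fin I X) n x \<oplus>\<^bsub>obj (cx_rprod fin I X) (n - 1)\<^esub> bdy (cx_rprod fin I X) n y"
        using mod_hom_add[OF is_complex_bdy[OF X] xi yi] by (auto simp: restrict_eq_restrict_iff)
    qed
    fix x assume "x \<in> carrier (obj (cx_rprod fin I X) n)"
    then have xi: "x i \<in> carrier (obj (X i) n)" if "i \<in> I" for i
      using that by (simp add: carrier_mod_rprod)
    show "bdy (cx_rprod fin I X) (n - 1) (bdy (cx_rprod fin I X) n x) =
        \<zero>\<^bsub>obj (cx_rprod fin I X) (n - 2)\<^esub>"
      using is_complex_bdy_bdy[OF X xi] by (auto simp: restrict_eq_restrict_iff)
  qed
qed

lemma mod_rprod_cong_submodule:
  "(\<And>i. i \<in> I \<Longrightarrow> A i \<subseteq> carrier (M i)) \<Longrightarrow>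
    mod_rprod fin I (\<lambda>i. submodule_on (M i) (A i)) =
      submodule_on (mod_rprod fin I M)
        {x \<in> carrier (mod_rprod fin I M). \<forall>i\<in>I. x i \<in> A i}"
  unfolding mod_rprod_def submodule_on_def mod_product_def
  by (auto simp: PiE_iff)

lemma cycles_cx_rprod:
  "cycles (cx_rprod fin I X) n = mod_rprod fin I (\<lambda>i. cycles (X i) n)"
proof -
  have "{x \<in> carrier (mod_rprod fin I (\<lambda>i. obj (X i) n)).
        (\<lambda>i\<in>I. bdy (X i) n (x i)) = (\<lambda>i\<in>I. \<zero>\<^bsub>obj (X i) (n - 1)\<^esub>)} =
      {x \<in> carrier (mod_rprod fin I (\<lambda>i. obj (X i) n)). \<forall>i\<in>I. x i \<in> carrier (cycles (X i) n)}"
    by (auto simp: restrict_eq_restrict_iff carrier_cycles carrier_mod_rprod)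
  moreover have "carrier (cycles (X i) n) \<subseteq> carrier (obj (X i) n)" for i
    by (auto simp: carrier_cycles)
  ultimately show ?thesis
    using mod_rprod_cong_submodule[of I "\<lambda>i. carrier (cycles (X i) n)" "\<lambda>i. obj (X i) n" fin]
    by (simp add: cycles_def)
qed

lemma piece_cx_rprod: "piece \<kappa> (cx_rprod fin I X) n = mod_rprod fin I (\<lambda>i. piece \<kappa> (X i) n)"
  by (simp add: piece_def cycles_cx_rprod)

text \<open>
  Preimages under the differential are chosen componentwise, with zero above zero; this keeps
  supports finite in the case of coproducts.
\<close>

lemma exact_cx_rprod:
  assumes X: "\<And>i. i \<in> I \<Longrightarrow> is_complex s R (X i)"
  shows "exact_complex (cx_rprod fin I X) \<longleftrightarrow> (\<forall>i\<in>I. exact_complex (X i))"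
proof
  assume exact: "exact_complex (cx_rprod fin I X)"
  show "\<forall>i\<in>I. exact_complex (X i)"
  proof
    fix i assume i: "i \<in> I"
    show "exact_complex (X i)"
      unfolding exact_complex_iff[OF X[OF i]]
    proof (intro allI ballI)
      fix n x assume x: "x \<in> carrier (cycles (X i) n)"
      \<comment> \<open>The cycle \<open>x\<close> is placed in component \<open>i\<close>; a preimage of the result is then projected.\<close>
      let ?x = "\<lambda>j\<in>I. if j = i then x else \<zero>\<^bsub>cycles (X j) n\<^esub>"
      have "finite {j \<in> I. ?x j \<noteq> \<zero>\<^bsub>cycles (X j) n\<^esub>}"
        by (rule finite_subset[of _ "{i}"]) auto
      moreover have "\<zero>\<^bsub>cycles (X j) n\<^esub> \<in> carrier (cycles (X j) n)" if "j \<in> I" for j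
        by (rule is_module_zero_closed[OF is_module_cycles[OF X[OF that]]])
      ultimately have "?x \<in> carrier (cycles (cx_rprod fin I X) n)"
        using x unfolding cycles_cx_rprod carrier_mod_rprod by simp
      then obtain y where y: "y \<in> carrier (obj (cx_rprod fin I X) (n + 1))"
        "bdy (cx_rprod fin I X) (n + 1) y = ?x"
        using exact_complex_preimage[OF exact] by blast
      have "(\<lambda>j\<in>I. bdy (X j) (n + 1) (y j)) i = ?x i" using y(2) by simp
      moreover have "y i \<in> carrier (obj (X i) (n + 1))" using y(1) i by (simp add: carrier_mod_rprod)
      ultimately show "\<exists>y\<in>carrier (obj (X i) (n + 1)). bdy (X i) (n + 1) y = x" using i by auto
    qed
  qed
next
  have P: "is_complex s R (cx_rprod fin I X)" using X by (rule is_complex_cx_rprod)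
  assume exact: "\<forall>i\<in>I. exact_complex (X i)"
  show "exact_complex (cx_rprod fin I X)"
    unfolding exact_complex_iff[OF P]
  proof (intro allI ballI)
    fix n x assume "x \<in> carrier (cycles (cx_rprod fin I X) n)"
    then have x: "x \<in> carrier (mod_rprod fin I (\<lambda>i. cycles (X i) n))" by (simp add: cycles_cx_rprod)
    have "\<exists>y. y \<in> carrier (obj (X i) (n + 1)) \<and> bdy (X i) (n + 1) y = x i \<and>
        (x i = \<zero>\<^bsub>obj (X i) n\<^esub> \<longrightarrow> y = \<zero>\<^bsub>obj (X i) (n + 1)\<^esub>)" if i: "i \<in> I" for i
    proof (cases "x i = \<zero>\<^bsub>obj (X i) n\<^esub>")
      case True
      have "bdy (X i) (n + 1) \<zero>\<^bsub>obj (X i) (n + 1)\<^esub> = \<zero>\<^bsub>obj (X i) n\<^esub>"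
        using mod_hom_zero[OF is_complex_bdy[OF X[OF i]]
            is_complex_obj_group[OF X[OF i]] is_complex_obj_group[OF X[OF i]], of "n + 1"] by simp
      then show ?thesis using True is_module_zero_closed[OF is_complex_obj[OF X[OF i]]] by auto
    next
      case False
      have "x i \<in> carrier (cycles (X i) n)" using x i by (simp add: carrier_mod_rprod)
      then show ?thesis
        using exact_complex_preimage[of "X i" "x i" n] exact i False by auto
    qed
    then obtain y where y: "\<And>i. i \<in> I \<Longrightarrow> y i \<in> carrier (obj (X i) (n + 1))"
      "\<And>i. i \<in> I \<Longrightarrow> bdy (X i) (n + 1) (y i) = x i"
      "\<And>i. i \<in> I \<Longrightarrow> x i = \<zero>\<^bsub>obj (X i) n\<^esub> \<Longrightarrow> y i = \<zero>\<^bsub>obj (X i) (n + 1)\<^esub>" by metis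
    have "(\<lambda>i\<in>I. y i) \<in> carrier (obj (cx_rprod fin I X) (n + 1))"
      unfolding obj_cx_rprod using y(1,3) by (intro carrier_mod_rprod_pointwise[OF x x]) auto
    moreover have "bdy (cx_rprod fin I X) (n + 1) (\<lambda>i\<in>I. y i) = x"
      using x y(2) by (intro extensionalityI[of _ I]) (auto simp: carrier_mod_rprod)
    ultimately show "\<exists>y\<in>carrier (obj (cx_rprod fin I X) (n + 1)).
        bdy (cx_rprod fin I X) (n + 1) y = x" by blast
  qed
qed

lemma admissible_cx_rprod:
  "(\<And>i. i \<in> I \<Longrightarrow> is_complex s R (X i)) \<Longrightarrow>
    admissible \<kappa> (cx_rprod fin I X) \<longleftrightarrow> (\<forall>i\<in>I. admissible \<kappa> (X i))"
  using exact_cx_rprod unfolding admissible_def by blast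


section \<open>Short exact sequences of complexes\<close>

lemma mod_short_exactD:
  assumes "mod_short_exact R L f M g N"
  shows "f \<in> mod_hom R L M" "g \<in> mod_hom R M N" "inj_on f (carrier L)"
    "\<And>x. x \<in> carrier L \<Longrightarrow> g (f x) = \<zero>\<^bsub>N\<^esub>"
    "\<And>y. y \<in> carrier M \<Longrightarrow> g y = \<zero>\<^bsub>N\<^esub> \<Longrightarrow> \<exists>x\<in>carrier L. f x = y"
    "\<And>z. z \<in> carrier N \<Longrightarrow> \<exists>y\<in>carrier M. g y = z"
proof -
  have eqs: "f ` carrier L = {x \<in> carrier M. g x = \<zero>\<^bsub>N\<^esub>}" "g ` carrier M = carrier N"
    using assms by (auto simp: mod_short_exact_def)
  show "f \<in> mod_hom R L M" "g \<in> mod_hom R M N" "inj_on f (carrier L)"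
    using assms by (auto simp: mod_short_exact_def)
  show "g (f x) = \<zero>\<^bsub>N\<^esub>" if "x \<in> carrier L" for x
    using imageI[OF that, of f] unfolding eqs by simp
  show "\<exists>x\<in>carrier L. f x = y" if "y \<in> carrier M" "g y = \<zero>\<^bsub>N\<^esub>" for y
  proof -
    have "y \<in> f ` carrier L" using that unfolding eqs by simp
    then show ?thesis by blast
  qed
  show "\<exists>y\<in>carrier M. g y = z" if "z \<in> carrier N" for z
  proof -
    have "z \<in> g ` carrier M" using that unfolding eqs .
    then show ?thesis by blast
  qed
qed

lemma mod_short_exactI:
  assumes "f \<in> mod_hom R L M" "g \<in> mod_hom R M N" "inj_on f (carrier L)"
    and gf: "\<And>x. x \<in> carrier L \<Longrightarrow> g (f x) = \<zero>\<^bsub>N\<^esub>"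
    and middle: "\<And>y. y \<in> carrier M \<Longrightarrow> g y = \<zero>\<^bsub>N\<^esub> \<Longrightarrow> \<exists>x\<in>carrier L. f x = y"
    and onto: "\<And>z. z \<in> carrier N \<Longrightarrow> \<exists>y\<in>carrier M. g y = z"
  shows "mod_short_exact R L f M g N"
proof -
  have "f ` carrier L = {x \<in> carrier M. g x = \<zero>\<^bsub>N\<^esub>}"
  proof
    show "f ` carrier L \<subseteq> {x \<in> carrier M. g x = \<zero>\<^bsub>N\<^esub>}"
      using gf mod_hom_closed[OF assms(1)] by auto
    show "{x \<in> carrier M. g x = \<zero>\<^bsub>N\<^esub>} \<subseteq> f ` carrier L" using middle by force
  qed
  moreover have "g ` carrier M = carrier N"
  proof
    show "g ` carrier M \<subseteq> carrier N" using mod_hom_closed[OF assms(2)] by auto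
    show "carrier N \<subseteq> g ` carrier M" using onto by force
  qed
  ultimately show ?thesis using assms(1-3) by (simp add: mod_short_exact_def)
qed

lemma mod_short_exact_differ_by_image:
  assumes ex: "mod_short_exact R L f M g N" and M: "abelian_group M" and N: "abelian_group N"
    and y: "y \<in> carrier M" "y' \<in> carrier M" "g y = g y'"
  obtains x where "x \<in> carrier L" "y = y' \<oplus>\<^bsub>M\<^esub> f x"
proof -
  interpret M: abelian_group M by fact
  interpret N: abelian_group N by fact
  note D = mod_short_exactD[OF ex]
  have "g (\<ominus>\<^bsub>M\<^esub> y' \<oplus>\<^bsub>M\<^esub> y) = \<ominus>\<^bsub>N\<^esub> g y' \<oplus>\<^bsub>N\<^esub> g y"
    using mod_hom_add[OF D(2)] mod_hom_minus[OF D(2) M N] y by simp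
  then have "g (\<ominus>\<^bsub>M\<^esub> y' \<oplus>\<^bsub>M\<^esub> y) = \<zero>\<^bsub>N\<^esub>"
    using y(3) N.l_neg mod_hom_closed[OF D(2) y(2)] by simp
  then obtain x where x: "x \<in> carrier L" "f x = \<ominus>\<^bsub>M\<^esub> y' \<oplus>\<^bsub>M\<^esub> y"
    using D(5) y by (metis M.a_inv_closed M.a_closed)
  then have "y = y' \<oplus>\<^bsub>M\<^esub> f x" using y by (simp add: M.r_neg2)
  then show ?thesis using x(1) that by blast
qed

text \<open>
  Exactness in the middle: lift a preimage of the image of a cycle, correct the difference, which
  comes from a cycle of the subcomplex, and use exactness there.
\<close>

lemma cx_short_exact_middle_exact:
  assumes ses: "cx_short_exact R X f Y g Z" and X: "is_complex s R X" and Y: "is_complex s R Y"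
    and Z: "is_complex s R Z" and exX: "exact_complex X" and exZ: "exact_complex Z"
  shows "exact_complex Y"
  unfolding exact_complex_iff[OF Y]
proof (intro allI ballI)
  fix n y assume y: "y \<in> carrier (cycles Y n)"
  have f: "f \<in> chain_map R X Y" and g: "g \<in> chain_map R Y Z"
    and ex: "\<And>n. mod_short_exact R (obj X n) (f n) (obj Y n) (g n) (obj Z n)"
    using ses by (auto simp: cx_short_exact_def)
  note grpY = is_complex_obj_group[OF Y] and grpZ = is_complex_obj_group[OF Z]
  have y': "y \<in> carrier (obj Y n)" "bdy Y n y = \<zero>\<^bsub>obj Y (n - 1)\<^esub>"
    using y by (simp_all add: carrier_cycles)
  obtain z where z: "z \<in> carrier (obj Z (n + 1))" "bdy Z (n + 1) z = g n y"
    using exact_complex_preimage[OF exZ chain_map_cycles[OF g Y Z y]] by blast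
  obtain w where w: "w \<in> carrier (obj Y (n + 1))" "g (n + 1) w = z"
    using mod_short_exactD(6)[OF ex z(1)] by blast
  note dw = bdy_in_cycles[OF Y w(1)]
  then have dw': "bdy Y (n + 1) w \<in> carrier (obj Y n)" by (simp add: carrier_cycles)
  have "g n y = g n (bdy Y (n + 1) w)" using chain_map_bdy_Suc[OF g w(1)] w(2) z(2) by simp
  then obtain x where x: "x \<in> carrier (obj X n)" "y = bdy Y (n + 1) w \<oplus>\<^bsub>obj Y n\<^esub> f n x"
    by (rule mod_short_exact_differ_by_image[OF ex grpY grpZ y'(1) dw'])
  have fx: "f n x \<in> carrier (obj Y n)" using chain_map_closed[OF f x(1)] .
  have "bdy Y n y = bdy Y n (bdy Y (n + 1) w) \<oplus>\<^bsub>obj Y (n - 1)\<^esub> bdy Y n (f n x)"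
    unfolding x(2) by (rule mod_hom_add[OF is_complex_bdy[OF Y] dw' fx])
  then have "f n x \<in> carrier (cycles Y n)"
    using y'(2) dw fx is_complex_bdy_closed[OF Y fx] abelian_monoid.l_zero[of "obj Y (n - 1)"]
      grpY[of "n - 1"]
    by (simp add: carrier_cycles abelian_group_def)
  then have "x \<in> carrier (cycles X n)"
    using chain_map_reflects_cycles[OF f X Y mod_short_exactD(3)[OF ex] x(1)] by blast
  then obtain v where v: "v \<in> carrier (obj X (n + 1))" "bdy X (n + 1) v = x"
    using exact_complex_preimage[OF exX] by blast
  have "bdy Y (n + 1) (w \<oplus>\<^bsub>obj Y (n + 1)\<^esub> f (n + 1) v) = y"
    using mod_hom_add[OF is_complex_bdy[OF Y] w(1) chain_map_closed[OF f v(1)]]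
      chain_map_bdy_Suc[OF f v(1)] v(2) x(2) by simp
  then show "\<exists>y'\<in>carrier (obj Y (n + 1)). bdy Y (n + 1) y' = y"
    using is_module_add_closed[OF is_complex_obj[OF Y] w(1) chain_map_closed[OF f v(1)]] by blast
qed

text \<open>
  The only part of the sequence of cycles that can fail to be exact is the right end. The boundary of
  a lift of a cycle of \<open>Z\<close> comes from a cycle of \<open>X\<close>; exactness of \<open>X\<close> allows to subtract it.
\<close>

lemma cx_short_exact_cycles:
  assumes ses: "cx_short_exact R X f Y g Z" and X: "is_complex s R X" and Y: "is_complex s R Y"
    and Z: "is_complex s R Z" and exX: "exact_complex X"
  shows "mod_short_exact R (cycles X n) (f n) (cycles Y n) (g n) (cycles Z n)"
proof (rule mod_short_exactI)
  have f: "f \<in> chain_map R X Y" and g: "g \<in> chain_map R Y Z"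
    and ex: "\<And>n. mod_short_exact R (obj X n) (f n) (obj Y n) (g n) (obj Z n)"
    using ses by (auto simp: cx_short_exact_def)
  note grpY = is_complex_obj_group[OF Y] and grpZ = is_complex_obj_group[OF Z]
  show "f n \<in> mod_hom R (cycles X n) (cycles Y n)" by (rule chain_map_cycles_hom[OF f X Y])
  show "g n \<in> mod_hom R (cycles Y n) (cycles Z n)" by (rule chain_map_cycles_hom[OF g Y Z])
  show "inj_on (f n) (carrier (cycles X n))"
    by (rule inj_on_subset[OF mod_short_exactD(3)[OF ex]]) (auto simp: carrier_cycles)
  show "g n (f n x) = \<zero>\<^bsub>cycles Z n\<^esub>" if "x \<in> carrier (cycles X n)" for x
    using mod_short_exactD(4)[OF ex] that by (simp add: carrier_cycles)
  show "\<exists>x\<in>carrier (cycles X n). f n x = y"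
    if y: "y \<in> carrier (cycles Y n)" "g n y = \<zero>\<^bsub>cycles Z n\<^esub>" for y
  proof -
    obtain x where x: "x \<in> carrier (obj X n)" "f n x = y"
      using mod_short_exactD(5)[OF ex, of y n] y by (auto simp: carrier_cycles)
    then have "x \<in> carrier (cycles X n)"
      using chain_map_reflects_cycles[OF f X Y mod_short_exactD(3)[OF ex] x(1)] y(1) by simp
    then show ?thesis using x(2) by blast
  qed
  show "\<exists>y\<in>carrier (cycles Y n). g n y = z" if z: "z \<in> carrier (cycles Z n)" for z
  proof -
    obtain y where y: "y \<in> carrier (obj Y n)" "g n y = z"
      using mod_short_exactD(6)[OF ex, of z n] z by (auto simp: carrier_cycles)
    have dy: "bdy Y n y \<in> carrier (obj Y (n - 1))" by (rule is_complex_bdy_closed[OF Y y(1)])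
    have "g (n - 1) (bdy Y n y) = \<zero>\<^bsub>obj Z (n - 1)\<^esub>"
      using chain_map_bdy[OF g y(1)] y(2) z by (simp add: carrier_cycles)
    then obtain x where x: "x \<in> carrier (obj X (n - 1))" "f (n - 1) x = bdy Y n y"
      using mod_short_exactD(5)[OF ex dy] by blast
    have "bdy Y n y \<in> carrier (cycles Y (n - 1))"
      using bdy_in_cycles[OF Y, of y "n - 1"] y(1) by simp
    then have "x \<in> carrier (cycles X (n - 1))"
      using chain_map_reflects_cycles[OF f X Y mod_short_exactD(3)[OF ex] x(1)] x(2) by simp
    then obtain v where v: "v \<in> carrier (obj X n)" "bdy X n v = x"
      using exact_complex_preimage[OF exX, of x "n - 1"] by auto
    interpret Yn: abelian_group "obj Y n" by (rule grpY)
    interpret Yp: abelian_group "obj Y (n - 1)" by (rule grpY)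
    interpret Zn: abelian_group "obj Z n" by (rule grpZ)
    let ?u = "f n v"
    have u: "?u \<in> carrier (obj Y n)" by (rule chain_map_closed[OF f v(1)])
    note d = is_complex_bdy[OF Y, of n] and gn = chain_map_hom[OF g, of n]
    have "bdy Y n ?u = bdy Y n y" using chain_map_bdy[OF f v(1)] v(2) x(2) by simp
    then have "bdy Y n (y \<oplus>\<^bsub>obj Y n\<^esub> \<ominus>\<^bsub>obj Y n\<^esub> ?u) = \<zero>\<^bsub>obj Y (n - 1)\<^esub>"
      using mod_hom_add[OF d y(1)] mod_hom_minus[OF d grpY grpY u] u dy by (simp add: Yp.r_neg)
    moreover have "g n (y \<oplus>\<^bsub>obj Y n\<^esub> \<ominus>\<^bsub>obj Y n\<^esub> ?u) = z"
      using mod_hom_add[OF gn y(1)] mod_hom_minus[OF gn grpY grpZ u] u y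
        mod_short_exactD(4)[OF ex v(1)] mod_hom_closed[OF gn y(1)] by simp
    ultimately show ?thesis
      using y(1) u by (intro bexI[of _ "y \<oplus>\<^bsub>obj Y n\<^esub> \<ominus>\<^bsub>obj Y n\<^esub> ?u"]) (auto simp: carrier_cycles)
  qed
qed

lemma cx_short_exact_piece:
  assumes "cx_short_exact R X f Y g Z" "is_complex s R X" "is_complex s R Y" "is_complex s R Z"
    "admissible \<kappa> X"
  shows "mod_short_exact R (piece \<kappa> X n) (f n) (piece \<kappa> Y n) (g n) (piece \<kappa> Z n)"
proof (cases "\<kappa> = Cyclewise")
  case True
  then show ?thesis using cx_short_exact_cycles[OF assms(1-4)] assms(5)
    by (simp add: piece_def admissible_def)
next
  case False
  then show ?thesis using assms(1) by (simp add: piece_def cx_short_exact_def)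
qed


section \<open>Discs\<close>

text \<open>
  Discs recover a module from the classes of complexes: besides zero modules, \<open>disc0 M\<close> has only \<open>M\<close>
  among its terms and only \<open>M\<close> among its cycles, the latter in degree \<open>- 1\<close>.
\<close>

lemma obj_disc0: "obj (disc0 M) n = (if n = 0 \<or> n = -1 then M else submodule_on M {\<zero>\<^bsub>M\<^esub>})"
  by (simp add: disc0_def)

lemma bdy_disc0: "bdy (disc0 M) n x = (if n = 0 then x else \<zero>\<^bsub>M\<^esub>)"
  by (simp add: disc0_def)

lemma cycles_disc0:
  assumes "is_module s R M"
  shows "cycles (disc0 M) n = (if n = -1 then M else submodule_on M {\<zero>\<^bsub>M\<^esub>})"
proof -
  have "{x \<in> carrier M. x = \<zero>\<^bsub>M\<^esub>} = {\<zero>\<^bsub>M\<^esub>}" using is_module_zero_closed[OF assms] by auto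
  then show ?thesis by (simp add: cycles_def obj_disc0 bdy_disc0)
qed

lemma is_complex_disc0:
  assumes M: "is_module s R M"
  shows "is_complex s R (disc0 M)"
proof -
  interpret abelian_group M using M by (rule is_module_abelian_group)
  have "bdy (disc0 M) n \<in> mod_hom R (obj (disc0 M) n) (obj (disc0 M) (n - 1))" for n
    using is_module_smult_zero[OF M] by (auto simp: mod_hom_def obj_disc0 bdy_disc0)
  then show ?thesis
    using M is_module_zero_submodule[OF M] by (auto simp: is_complex_def obj_disc0 bdy_disc0)
qed

lemma exact_disc0:
  assumes M: "is_module s R M"
  shows "exact_complex (disc0 M)"
  unfolding exact_complex_iff[OF is_complex_disc0[OF M]] cycles_disc0[OF M]
  using is_module_zero_closed[OF M] by (auto simp: obj_disc0 bdy_disc0)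

lemma piece_disc0: "is_module s R M \<Longrightarrow> piece \<kappa> (disc0 M) (- 1) = M"
  by (simp add: piece_def cycles_disc0 obj_disc0)

lemma piece_disc0_cases:
  "is_module s R M \<Longrightarrow> piece \<kappa> (disc0 M) n = M \<or> piece \<kappa> (disc0 M) n = submodule_on M {\<zero>\<^bsub>M\<^esub>}"
  by (auto simp: piece_def cycles_disc0 obj_disc0)

lemma chain_map_disc0:
  assumes f: "f \<in> mod_hom R M N" and M: "is_module s R M" and N: "is_module s R N"
  shows "(\<lambda>n. f) \<in> chain_map R (disc0 M) (disc0 N)"
proof -
  interpret M: abelian_group M using M by (rule is_module_abelian_group)
  interpret N: abelian_group N using N by (rule is_module_abelian_group)
  have "f \<zero>\<^bsub>M\<^esub> = \<zero>\<^bsub>N\<^esub>"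
    by (rule mod_hom_zero[OF f M.abelian_group_axioms N.abelian_group_axioms])
  then show ?thesis
    using f is_module_smult_zero[OF M] is_module_smult_zero[OF N]
    by (auto simp: chain_map_def obj_disc0 bdy_disc0 mod_hom_def)
qed

lemma cx_isomorphic_disc0:
  assumes iso: "mod_isomorphic R M N" and M: "is_module s R M" and N: "is_module s R N"
  shows "cx_isomorphic R (disc0 M) (disc0 N)"
proof -
  obtain f where f: "f \<in> mod_hom R M N" "bij_betw f (carrier M) (carrier N)"
    using iso by (rule mod_isomorphicE)
  have "f \<zero>\<^bsub>M\<^esub> = \<zero>\<^bsub>N\<^esub>"
    using mod_hom_zero[OF f(1)] M N by (simp add: is_module_abelian_group)
  then have "bij_betw f (carrier (obj (disc0 M) n)) (carrier (obj (disc0 N) n))" for n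
    using f(2) by (auto simp: obj_disc0 bij_betw_def)
  then show ?thesis
    unfolding cx_isomorphic_def by (intro bexI[OF _ chain_map_disc0[OF f(1) M N]] allI)
qed

lemma disc0_rprod_isomorphic:
  assumes iso: "mod_isomorphic R P (mod_rprod fin I N)" and P: "is_module s R P"
    and N: "\<And>i. i \<in> I \<Longrightarrow> is_module s R (N i)"
  shows "cx_isomorphic R (disc0 P) (cx_rprod fin I (\<lambda>i. disc0 (N i)))"
proof -
  let ?S = "mod_rprod fin I N" and ?X = "cx_rprod fin I (\<lambda>i. disc0 (N i))"
  have S: "is_module s R ?S" using N by (rule is_module_mod_rprod)
  obtain f where f: "f \<in> chain_map R (disc0 P) (disc0 ?S)"
    and bij: "\<And>n. bij_betw (f n) (carrier (obj (disc0 P) n)) (carrier (obj (disc0 ?S) n))"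
    using cx_isomorphic_disc0[OF iso P S] by (auto simp: cx_isomorphic_def)
  have "{x \<in> carrier ?S. \<forall>i\<in>I. x i \<in> {\<zero>\<^bsub>N i\<^esub>}} = {\<zero>\<^bsub>?S\<^esub>}"
    using is_module_zero_closed[OF N]
    by (auto simp: carrier_mod_rprod intro!: extensionalityI[of _ I])
  then have "mod_rprod fin I (\<lambda>i. submodule_on (N i) {\<zero>\<^bsub>N i\<^esub>}) = submodule_on ?S {\<zero>\<^bsub>?S\<^esub>}"
    using mod_rprod_cong_submodule[of I "\<lambda>i. {\<zero>\<^bsub>N i\<^esub>}" N fin] is_module_zero_closed[OF N]
    by simp
  then have obj: "obj ?X n = obj (disc0 ?S) n" for n
    by (simp add: obj_disc0)
  have "bdy ?X n x = bdy (disc0 ?S) n x" if "x \<in> carrier (obj (disc0 ?S) n)" for n x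
  proof (cases "n = 0")
    case True
    then have "x \<in> extensional I" using that by (simp add: obj_disc0 carrier_mod_rprod)
    then show ?thesis
      using True by (intro extensionalityI[of _ I]) (auto simp: bdy_disc0)
  qed (simp add: bdy_disc0)
  then have "f \<in> chain_map R (disc0 P) ?X"
    using f mod_hom_closed[OF chain_map_hom[OF f]] unfolding chain_map_def obj by auto
  then show ?thesis
    using bij unfolding cx_isomorphic_def obj by blast
qed

lemma cx_short_exact_disc0:
  assumes ses: "mod_short_exact R L f M g N"
    and L: "is_module s R L" and M: "is_module s R M" and N: "is_module s R N"
  shows "cx_short_exact R (disc0 L) (\<lambda>n. f) (disc0 M) (\<lambda>n. g) (disc0 N)"
proof -
  note D = mod_short_exactD[OF ses]
  note f = chain_map_disc0[OF D(1) L M] and g = chain_map_disc0[OF D(2) M N]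
  have zero: "f \<zero>\<^bsub>L\<^esub> = \<zero>\<^bsub>M\<^esub>" "g \<zero>\<^bsub>M\<^esub> = \<zero>\<^bsub>N\<^esub>"
    using mod_hom_zero[OF D(1)] mod_hom_zero[OF D(2)] L M N by (auto simp: is_module_abelian_group)
  have "mod_short_exact R (obj (disc0 L) n) f (obj (disc0 M) n) g (obj (disc0 N) n)" for n
  proof (cases "n = 0 \<or> n = - 1")
    case True
    then show ?thesis using ses by (simp add: obj_disc0)
  next
    case False
    then show ?thesis
      using chain_map_hom[OF f, of n] chain_map_hom[OF g, of n] zero
      by (intro mod_short_exactI) (auto simp: obj_disc0)
  qed
  then show ?thesis using f g by (simp add: cx_short_exact_def)
qed


section \<open>Transfer of closure properties\<close>

definition contains_zero_modules ::
  "side \<Rightarrow> ('r, 'k) ring_scheme \<Rightarrow> ('r, 'm) module set \<Rightarrow> bool" where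
  "contains_zero_modules s R \<M> \<longleftrightarrow>
     (\<forall>Z. is_module s R Z \<and> carrier Z = {\<zero>\<^bsub>Z\<^esub>} \<longrightarrow> Z \<in> \<M>)"

definition mod_rclosed ::
  "bool \<Rightarrow> 'i set \<Rightarrow> side \<Rightarrow> ('r, 'k) ring_scheme \<Rightarrow> ('r, 'm) module set \<Rightarrow> bool" where
  "mod_rclosed fin I s R \<M> \<longleftrightarrow>
     (\<forall>N P. (\<forall>i\<in>I. N i \<in> \<M>) \<and> is_module s R P \<and>
        mod_isomorphic R P (mod_rprod fin I N) \<longrightarrow> P \<in> \<M>)"

definition cx_rclosed ::
  "bool \<Rightarrow> 'i set \<Rightarrow> side \<Rightarrow> ('r, 'k) ring_scheme \<Rightarrow> ('r, 'm) mod_complex set \<Rightarrow> bool" where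
  "cx_rclosed fin I s R \<M> \<longleftrightarrow>
     (\<forall>X P. (\<forall>i\<in>I. X i \<in> \<M>) \<and> is_complex s R P \<and>
        cx_isomorphic R P (cx_rprod fin I X) \<longrightarrow> P \<in> \<M>)"

lemma mod_rclosedD:
  assumes "mod_rclosed fin I s R \<M>" "\<And>i. i \<in> I \<Longrightarrow> N i \<in> \<M>" "is_module s R P"
    "mod_isomorphic R P (mod_rprod fin I N)"
  shows "P \<in> \<M>"
  using assms(1)[unfolded mod_rclosed_def, rule_format, of N P] assms(2-4) by simp

lemma cx_rclosedD:
  assumes "cx_rclosed fin I s R \<X>" "\<And>i. i \<in> I \<Longrightarrow> X i \<in> \<X>" "is_complex s R P"
    "cx_isomorphic R P (cx_rprod fin I X)"
  shows "P \<in> \<X>"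
  using assms(1)[unfolded cx_rclosed_def, rule_format, of X P] assms(2-4) by simp

lemma mod_product_closed_iff:
  "mod_product_closed TYPE('i) s R \<M> \<longleftrightarrow> (\<forall>I :: 'i set. mod_rclosed False I s R \<M>)"
  by (simp add: mod_product_closed_def mod_rclosed_def mod_product_eq_rprod)

lemma mod_coproduct_closed_iff:
  "mod_coproduct_closed TYPE('i) s R \<M> \<longleftrightarrow> (\<forall>I :: 'i set. mod_rclosed True I s R \<M>)"
  by (simp add: mod_coproduct_closed_def mod_rclosed_def mod_coproduct_eq_rprod)

lemma mod_finite_sum_closed_iff:
  "mod_finite_sum_closed s R \<M> \<longleftrightarrow> (\<forall>n. mod_rclosed True {..<n :: nat} s R \<M>)"
  by (auto simp: mod_finite_sum_closed_def mod_rclosed_def mod_coproduct_eq_rprod)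

lemma cx_product_closed_iff:
  "cx_product_closed TYPE('i) s R \<X> \<longleftrightarrow> (\<forall>I :: 'i set. cx_rclosed False I s R \<X>)"
  by (simp add: cx_product_closed_def cx_rclosed_def cx_product_eq_rprod)

lemma cx_coproduct_closed_iff:
  "cx_coproduct_closed TYPE('i) s R \<X> \<longleftrightarrow> (\<forall>I :: 'i set. cx_rclosed True I s R \<X>)"
  by (simp add: cx_coproduct_closed_def cx_rclosed_def cx_coproduct_eq_rprod)

lemma cx_finite_sum_closed_iff:
  "cx_finite_sum_closed s R \<X> \<longleftrightarrow> (\<forall>n. cx_rclosed True {..<n :: nat} s R \<X>)"
  by (auto simp: cx_finite_sum_closed_def cx_rclosed_def cx_coproduct_eq_rprod)

lemma kind_class_subset_complexes: "kind_class \<kappa> s R \<M> \<subseteq> Collect (is_complex s R)"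
  by (auto simp: kind_class_iff)

lemma disc0_in_kind_class:
  assumes zero: "contains_zero_modules s R \<M>" and M: "is_module s R M"
  shows "disc0 M \<in> kind_class \<kappa> s R \<M> \<longleftrightarrow> M \<in> \<M>"
proof -
  have "submodule_on M {\<zero>\<^bsub>M\<^esub>} \<in> \<M>"
    using zero is_module_zero_submodule[OF M] by (simp add: contains_zero_modules_def)
  then have "(\<forall>n. piece \<kappa> (disc0 M) n \<in> \<M>) \<longleftrightarrow> M \<in> \<M>"
    using piece_disc0[OF M] piece_disc0_cases[OF M] by metis
  then show ?thesis
    using is_complex_disc0[OF M] exact_disc0[OF M] by (simp add: kind_class_iff admissible_def)
qed

text \<open>
  Pieces commute with products and coproducts, so closure passes from modules to complexes; discs
  commute with them up to isomorphism, which gives the converse.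
\<close>

lemma kind_class_rclosed:
  fixes \<M> :: "('r, 'm) module set" and I :: "'i set"
  assumes closed: "mod_rclosed fin I s R \<M>"
  shows "cx_rclosed fin I s R (kind_class \<kappa> s R \<M>)"
  unfolding cx_rclosed_def
proof (intro allI impI, elim conjE)
  fix X :: "'i \<Rightarrow> ('r, 'm) mod_complex" and P :: "('r, 'm) mod_complex"
  assume X: "\<forall>i\<in>I. X i \<in> kind_class \<kappa> s R \<M>" and P: "is_complex s R P"
    and iso: "cx_isomorphic R P (cx_rprod fin I X)"
  have Xc: "is_complex s R (X i)" if "i \<in> I" for i using X that by (simp add: kind_class_iff)
  then have S: "is_complex s R (cx_rprod fin I X)" by (rule is_complex_cx_rprod)
  have "admissible \<kappa> P"
    using cx_isomorphic_admissible[OF iso P S] admissible_cx_rprod[OF Xc, where I = I and \<kappa> = \<kappa> and fin = fin] X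
    by (simp add: kind_class_iff)
  moreover have "piece \<kappa> P n \<in> \<M>" for n
  proof -
    have "piece \<kappa> (X i) n \<in> \<M>" if "i \<in> I" for i
      using X that by (simp add: kind_class_iff)
    moreover have "mod_isomorphic R (piece \<kappa> P n) (mod_rprod fin I (\<lambda>i. piece \<kappa> (X i) n))"
      using cx_isomorphic_piece[OF iso P S] by (simp add: piece_cx_rprod)
    ultimately show ?thesis by (rule mod_rclosedD[OF closed _ is_module_piece[OF P]])
  qed
  ultimately show "P \<in> kind_class \<kappa> s R \<M>" using P by (simp add: kind_class_iff)
qed

lemma kind_class_rclosed_iff:
  fixes \<M> :: "('r, 'm) module set" and I :: "'i set"
  assumes sub: "\<M> \<subseteq> Collect (is_module s R)" and zero: "contains_zero_modules s R \<M>"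
  shows "cx_rclosed fin I s R (kind_class \<kappa> s R \<M>) \<longleftrightarrow> mod_rclosed fin I s R \<M>"
proof
  assume closed: "cx_rclosed fin I s R (kind_class \<kappa> s R \<M>)"
  show "mod_rclosed fin I s R \<M>"
    unfolding mod_rclosed_def
  proof (intro allI impI, elim conjE)
    fix N :: "'i \<Rightarrow> ('r, 'm) module" and P :: "('r, 'm) module"
    assume N: "\<forall>i\<in>I. N i \<in> \<M>" and P: "is_module s R P"
      and iso: "mod_isomorphic R P (mod_rprod fin I N)"
    have Nm: "is_module s R (N i)" if "i \<in> I" for i using N sub that by blast
    have "disc0 (N i) \<in> kind_class \<kappa> s R \<M>" if "i \<in> I" for i
      using disc0_in_kind_class[OF zero Nm[OF that]] N that by simp
    moreover have "cx_isomorphic R (disc0 P) (cx_rprod fin I (\<lambda>i. disc0 (N i)))"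
      using Nm by (rule disc0_rprod_isomorphic[OF iso P])
    ultimately have "disc0 P \<in> kind_class \<kappa> s R \<M>"
      by (rule cx_rclosedD[OF closed _ is_complex_disc0[OF P]])
    then show "P \<in> \<M>" using disc0_in_kind_class[OF zero P] by simp
  qed
qed (rule kind_class_rclosed)

text \<open>The empty sum provides the zero modules that discs need.\<close>

lemma contains_zero_modules_of_finite_sums:
  assumes "mod_finite_sum_closed s R \<M>"
  shows "contains_zero_modules s R \<M>"
  using mod_finite_sum_closed_zero[OF assms] by (auto simp: contains_zero_modules_def)

lemma contains_zero_modules_of_complex_sums:
  fixes \<M> :: "('r, 'm) module set"
  assumes closed: "cx_finite_sum_closed s R (kind_class \<kappa> s R \<M>)"
  shows "contains_zero_modules s R \<M>"
  unfolding contains_zero_modules_def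
proof (intro allI impI, elim conjE)
  fix Z :: "('r, 'm) module" assume Z: "is_module s R Z" "carrier Z = {\<zero>\<^bsub>Z\<^esub>}"
  have "mod_isomorphic R Z (mod_rprod True {..<0 :: nat} (\<lambda>_. Z))"
    using isomorphic_empty_sum[OF Z] by (simp add: mod_coproduct_eq_rprod)
  then have "cx_isomorphic R (disc0 Z) (cx_rprod True {..<0 :: nat} (\<lambda>i. disc0 Z))"
    by (rule disc0_rprod_isomorphic[OF _ Z(1)]) simp
  then have "disc0 Z \<in> kind_class \<kappa> s R \<M>"
    using closed is_complex_disc0[OF Z(1)] unfolding cx_finite_sum_closed_iff cx_rclosed_def
    by (metis emptyE lessThan_0)
  then show "Z \<in> \<M>" using piece_disc0[OF Z(1)] kind_class_iff by metis
qed

lemma kind_class_finite_sum_closed_iff: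
  assumes sub: "\<M> \<subseteq> Collect (is_module s R)"
  shows "cx_finite_sum_closed s R (kind_class \<kappa> s R \<M>) \<longleftrightarrow> mod_finite_sum_closed s R \<M>"
  using contains_zero_modules_of_finite_sums contains_zero_modules_of_complex_sums
    kind_class_rclosed_iff[OF sub] unfolding cx_finite_sum_closed_iff mod_finite_sum_closed_iff
  by (metis cx_finite_sum_closed_iff mod_finite_sum_closed_iff)

lemma kind_class_summand_closed_iff:
  fixes \<C> :: "('r, 'm) module set"
  assumes sub: "\<C> \<subseteq> Collect (is_module s R)" and zero: "contains_zero_modules s R \<C>"
  shows "cx_summand_closed s R (kind_class \<kappa> s R \<C>) \<longleftrightarrow> mod_summand_closed s R \<C>"
proof
  assume closed: "mod_summand_closed s R \<C>"
  show "cx_summand_closed s R (kind_class \<kappa> s R \<C>)"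
    unfolding cx_summand_closed_def
  proof (intro ballI allI impI, elim conjE)
    fix Y A B :: "('r, 'm) mod_complex"
    let ?F = "\<lambda>b :: bool. if b then A else B"
    assume Y: "Y \<in> kind_class \<kappa> s R \<C>" and A: "is_complex s R A" and B: "is_complex s R B"
      and iso: "cx_isomorphic R Y (cx_coproduct UNIV ?F)"
    have F: "is_complex s R (?F b)" for b using A B by simp
    have S: "is_complex s R (cx_rprod True UNIV ?F)" using F by (rule is_complex_cx_rprod)
    have Yc: "is_complex s R Y" using Y by (simp add: kind_class_iff)
    have iso': "cx_isomorphic R Y (cx_rprod True UNIV ?F)"
      using iso by (simp add: cx_coproduct_eq_rprod)
    have "\<forall>b\<in>UNIV. admissible \<kappa> (?F b)"
      using cx_isomorphic_admissible[OF iso' Yc S, of \<kappa>] Y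
        admissible_cx_rprod[of UNIV s R ?F \<kappa> True] F by (simp add: kind_class_iff)
    then have "admissible \<kappa> A" by (metis (full_types) UNIV_I)
    moreover have "piece \<kappa> A n \<in> \<C>" for n
    proof -
      have "(\<lambda>b. piece \<kappa> (?F b) n) = (\<lambda>b. if b then piece \<kappa> A n else piece \<kappa> B n)" by auto
      then have "mod_isomorphic R (piece \<kappa> Y n)
          (mod_coproduct UNIV (\<lambda>b :: bool. if b then piece \<kappa> A n else piece \<kappa> B n))"
        using cx_isomorphic_piece[OF iso' Yc S, of \<kappa> n]
        by (simp add: piece_cx_rprod mod_coproduct_eq_rprod)
      moreover have "piece \<kappa> Y n \<in> \<C>" using Y by (simp add: kind_class_iff)
      ultimately show ?thesis
        using closed is_module_piece[OF A] is_module_piece[OF B]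
        unfolding mod_summand_closed_def by blast
    qed
    ultimately show "A \<in> kind_class \<kappa> s R \<C>" using A by (simp add: kind_class_iff)
  qed
next
  assume closed: "cx_summand_closed s R (kind_class \<kappa> s R \<C>)"
  show "mod_summand_closed s R \<C>"
    unfolding mod_summand_closed_def
  proof (intro ballI allI impI, elim conjE)
    fix N A B :: "('r, 'm) module"
    let ?F = "\<lambda>b :: bool. if b then A else B"
    assume N: "N \<in> \<C>" and A: "is_module s R A" and B: "is_module s R B"
      and iso: "mod_isomorphic R N (mod_coproduct UNIV ?F)"
    have F: "is_module s R (?F b)" for b using A B by simp
    have Nm: "is_module s R N" using N sub by blast
    have "(\<lambda>b. disc0 (?F b)) = (\<lambda>b. if b then disc0 A else disc0 B)" by auto
    then have "cx_isomorphic R (disc0 N)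
        (cx_coproduct UNIV (\<lambda>b :: bool. if b then disc0 A else disc0 B))"
      using disc0_rprod_isomorphic[of R N True UNIV ?F s] iso Nm F
      by (simp add: mod_coproduct_eq_rprod cx_coproduct_eq_rprod)
    moreover have "disc0 N \<in> kind_class \<kappa> s R \<C>" using disc0_in_kind_class[OF zero Nm] N by simp
    ultimately have "disc0 A \<in> kind_class \<kappa> s R \<C>"
      using closed is_complex_disc0[OF A] is_complex_disc0[OF B]
      unfolding cx_summand_closed_def by blast
    then show "A \<in> \<C>" using disc0_in_kind_class[OF zero A] by simp
  qed
qed

lemma kind_class_extension_closed_iff:
  fixes \<M> :: "('r, 'm) module set"
  assumes sub: "\<M> \<subseteq> Collect (is_module s R)" and zero: "contains_zero_modules s R \<M>"
  shows "cx_extension_closed s R (kind_class \<kappa> s R \<M>) \<longleftrightarrow> mod_extension_closed s R \<M>"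
proof
  assume closed: "mod_extension_closed s R \<M>"
  show "cx_extension_closed s R (kind_class \<kappa> s R \<M>)"
    unfolding cx_extension_closed_def
  proof (intro allI impI, elim conjE)
    fix X Y Z :: "('r, 'm) mod_complex" and f g
    assume X: "X \<in> kind_class \<kappa> s R \<M>" and Z: "Z \<in> kind_class \<kappa> s R \<M>"
      and Y: "is_complex s R Y" and ses: "cx_short_exact R X f Y g Z"
    have Xc: "is_complex s R X" "admissible \<kappa> X" and Zc: "is_complex s R Z" "admissible \<kappa> Z"
      using X Z by (auto simp: kind_class_iff)
    have "admissible \<kappa> Y"
      using cx_short_exact_middle_exact[OF ses Xc(1) Y Zc(1)] Xc(2) Zc(2)
      by (auto simp: admissible_def)
    moreover have "piece \<kappa> Y n \<in> \<M>" for n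
    proof -
      have "piece \<kappa> X n \<in> \<M>" "piece \<kappa> Z n \<in> \<M>" using X Z by (auto simp: kind_class_iff)
      then show ?thesis
        using closed is_module_piece[OF Y] cx_short_exact_piece[OF ses Xc(1) Y Zc(1) Xc(2)]
        unfolding mod_extension_closed_def by blast
    qed
    ultimately show "Y \<in> kind_class \<kappa> s R \<M>" using Y by (simp add: kind_class_iff)
  qed
next
  assume closed: "cx_extension_closed s R (kind_class \<kappa> s R \<M>)"
  show "mod_extension_closed s R \<M>"
    unfolding mod_extension_closed_def
  proof (intro allI impI, elim conjE)
    fix L M N :: "('r, 'm) module" and f g
    assume LN: "L \<in> \<M>" "N \<in> \<M>" and M: "is_module s R M"
      and ses: "mod_short_exact R L f M g N"
    have L: "is_module s R L" and N: "is_module s R N" using LN sub by auto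
    have "disc0 L \<in> kind_class \<kappa> s R \<M>" "disc0 N \<in> kind_class \<kappa> s R \<M>"
      using LN disc0_in_kind_class[OF zero L] disc0_in_kind_class[OF zero N] by auto
    then have "disc0 M \<in> kind_class \<kappa> s R \<M>"
      using closed is_complex_disc0[OF M] cx_short_exact_disc0[OF ses L M N]
      unfolding cx_extension_closed_def by blast
    then show "M \<in> \<M>" using disc0_in_kind_class[OF zero M] by simp
  qed
qed

lemma is_module_regular_module:
  assumes "ring R"
  shows "is_module s R (regular_module s R)"
proof -
  interpret ring R by fact
  have "abelian_group (regular_module s R)"
    by (rule abelian_groupI) (auto simp: regular_module_def a_ac intro: l_neg)
  then show ?thesis
    by (cases s) (auto simp: is_module_def regular_module_def l_distr r_distr m_assoc)
qed

lemma kind_class_regular_iff: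
  assumes R: "ring R" and sub: "\<M> \<subseteq> Collect (is_module s R)"
    and zero: "contains_zero_modules s R \<M>"
  shows "(\<exists>X\<in>kind_class \<kappa> s R \<M>. cx_isomorphic R X (disc0 (regular_module s R))) \<longleftrightarrow>
    (\<exists>N\<in>\<M>. mod_isomorphic R N (regular_module s R))"
proof
  note reg = is_module_regular_module[OF R, of s]
  assume "\<exists>X\<in>kind_class \<kappa> s R \<M>. cx_isomorphic R X (disc0 (regular_module s R))"
  then obtain X where X: "is_complex s R X" "piece \<kappa> X (- 1) \<in> \<M>"
    "cx_isomorphic R X (disc0 (regular_module s R))" by (auto simp: kind_class_iff)
  then have "mod_isomorphic R (piece \<kappa> X (- 1)) (regular_module s R)"
    using cx_isomorphic_piece[OF X(3,1) is_complex_disc0[OF reg], of \<kappa> "- 1"] piece_disc0[OF reg]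
    by simp
  then show "\<exists>N\<in>\<M>. mod_isomorphic R N (regular_module s R)" using X(2) by blast
next
  note reg = is_module_regular_module[OF R, of s]
  assume "\<exists>N\<in>\<M>. mod_isomorphic R N (regular_module s R)"
  then obtain N where N: "N \<in> \<M>" "mod_isomorphic R N (regular_module s R)" by blast
  then have Nm: "is_module s R N" using sub by blast
  then have "disc0 N \<in> kind_class \<kappa> s R \<M>" using disc0_in_kind_class[OF zero] N(1) by blast
  then show "\<exists>X\<in>kind_class \<kappa> s R \<M>. cx_isomorphic R X (disc0 (regular_module s R))"
    using cx_isomorphic_disc0[OF N(2) Nm reg] by blast
qed


section \<open>Duality pairs and dual pairs correspond\<close>

lemma duality_pair_contains_zero_modules:
  fixes \<M> :: "('r, 'm) module set"
  assumes "duality_pair s R \<M> \<C>"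
  shows "contains_zero_modules s R \<M>"
  unfolding contains_zero_modules_def
proof (intro allI impI, elim conjE)
  fix Z :: "('r, 'm) module" assume Z: "is_module s R Z" "carrier Z = {\<zero>\<^bsub>Z\<^esub>}"
  have "carrier (mod_dual Z) = {\<zero>\<^bsub>mod_dual Z\<^esub>}"
    by (rule carrier_mod_dual_zero[OF is_module_abelian_group[OF Z(1)] Z(2)])
  then have "mod_dual Z \<in> \<C>"
    using mod_finite_sum_closed_zero[OF _ is_module_mod_dual[OF Z(1)]] assms
    by (auto simp: duality_pair_def)
  then show "Z \<in> \<M>" using assms Z(1) by (auto simp: duality_pair_def)
qed

text \<open>
  If the modules form a duality pair, then \<open>X\<close> lies in the class iff its pieces lie in \<open>\<M>\<close>, iff the
  duals of the pieces lie in \<open>\<C>\<close>, iff the dual of \<open>X\<close> lies in the class. Conversely this chain is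
  read off at discs. There it determines membership of the duals of \<open>M\<close> and of a zero module; so zero
  modules have to be in \<open>\<C>\<close>, which the empty sum ensures, and in \<open>\<M>\<close>, which follows by the same chain
  for discs of zero modules.
\<close>

theorem dual_pair_kind_class_iff:
  fixes \<M> :: "('r, 'm) module set" and \<C> :: "('r, 'm \<Rightarrow> qz) module set"
  assumes subM: "\<M> \<subseteq> Collect (is_module s R)"
    and subC: "\<C> \<subseteq> Collect (is_module (opposite s) R)"
  shows "dual_pair s R (kind_class \<kappa> s R \<M>) (kind_class \<kappa> (opposite s) R \<C>) \<longleftrightarrow>
    duality_pair s R \<M> \<C>"
proof (cases "mod_finite_sum_closed (opposite s) R \<C> \<and> mod_summand_closed (opposite s) R \<C>")
  case False
  then show ?thesis
    using kind_class_finite_sum_closed_iff[OF subC] kind_class_summand_closed_iff[OF subC]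
      contains_zero_modules_of_finite_sums
    unfolding duality_pair_def dual_pair_def by blast
next
  case True
  then have zeroC: "contains_zero_modules (opposite s) R \<C>"
    using contains_zero_modules_of_finite_sums by blast
  have dual: "cx_dual X \<in> kind_class \<kappa> (opposite s) R \<C> \<longleftrightarrow>
      admissible \<kappa> X \<and> (\<forall>n. mod_dual (piece \<kappa> X n) \<in> \<C>)" if "is_complex s R X" for X
    using cx_dual_in_kind_class[OF that] True by blast
  have "(\<forall>X. is_complex s R X \<longrightarrow>
        (X \<in> kind_class \<kappa> s R \<M> \<longleftrightarrow> cx_dual X \<in> kind_class \<kappa> (opposite s) R \<C>)) \<longleftrightarrow>
      (\<forall>M. is_module s R M \<longrightarrow> (M \<in> \<M> \<longleftrightarrow> mod_dual M \<in> \<C>))" (is "?cx \<longleftrightarrow> ?mod")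
  proof
    assume ?mod
    then have "piece \<kappa> X n \<in> \<M> \<longleftrightarrow> mod_dual (piece \<kappa> X n) \<in> \<C>" if "is_complex s R X" for X n
      using is_module_piece[OF that] by blast
    then show ?cx using dual by (simp add: kind_class_iff)
  next
    assume cx: ?cx
    have dual_disc0: "disc0 M \<in> kind_class \<kappa> s R \<M> \<longleftrightarrow> mod_dual M \<in> \<C>"
      if M: "is_module s R M" for M
    proof -
      let ?Z = "submodule_on M {\<zero>\<^bsub>M\<^esub>}"
      have Z: "is_module s R ?Z" by (rule is_module_zero_submodule[OF M])
      have "carrier (mod_dual ?Z) = {\<zero>\<^bsub>mod_dual ?Z\<^esub>}"
        by (rule carrier_mod_dual_zero[OF is_module_abelian_group[OF Z]]) simp
      then have "mod_dual ?Z \<in> \<C>"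
        using zeroC is_module_mod_dual[OF Z] unfolding contains_zero_modules_def by blast
      then have "(\<forall>n. mod_dual (piece \<kappa> (disc0 M) n) \<in> \<C>) \<longleftrightarrow> mod_dual M \<in> \<C>"
        using piece_disc0[OF M] piece_disc0_cases[OF M] by metis
      then show ?thesis
        using cx dual[OF is_complex_disc0[OF M]] is_complex_disc0[OF M] exact_disc0[OF M]
        by (simp add: admissible_def)
    qed
    have "contains_zero_modules s R \<M>"
      unfolding contains_zero_modules_def
    proof (intro allI impI, elim conjE)
      fix Z :: "('r, 'm) module" assume Z: "is_module s R Z" "carrier Z = {\<zero>\<^bsub>Z\<^esub>}"
      have "mod_dual Z \<in> \<C>"
        using zeroC is_module_mod_dual[OF Z(1)]
          carrier_mod_dual_zero[OF is_module_abelian_group[OF Z(1)] Z(2)]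
        unfolding contains_zero_modules_def by blast
      then have "disc0 Z \<in> kind_class \<kappa> s R \<M>" using dual_disc0[OF Z(1)] by simp
      then show "Z \<in> \<M>" using piece_disc0[OF Z(1)] kind_class_iff by metis
    qed
    then show ?mod using disc0_in_kind_class dual_disc0 by blast
  qed
  then show ?thesis
    unfolding duality_pair_def dual_pair_def
    using True kind_class_finite_sum_closed_iff[OF subC, of \<kappa>]
      kind_class_summand_closed_iff[OF subC zeroC, of \<kappa>] subM subC
    by (simp only: kind_class_subset_complexes)
qed

theorem closed_pairs_kind_class_iff:
  fixes \<M> :: "('r, 'm) module set" and \<C> :: "('r, 'm \<Rightarrow> qz) module set"
    and \<kappa> :: cx_kind
  assumes R: "ring R" and subM: "\<M> \<subseteq> Collect (is_module s R)"
    and subC: "\<C> \<subseteq> Collect (is_module (opposite s) R)"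
  defines "\<X> \<equiv> kind_class \<kappa> s R \<M>" and "\<Y> \<equiv> kind_class \<kappa> (opposite s) R \<C>"
  shows "product_closed_dual_pair TYPE('i) s R \<X> \<Y> \<longleftrightarrow>
      product_closed_duality_pair TYPE('i) s R \<M> \<C>"
    and "coproduct_closed_dual_pair TYPE('i) s R \<X> \<Y> \<longleftrightarrow>
      coproduct_closed_duality_pair TYPE('i) s R \<M> \<C>"
    and "perfect_dual_pair TYPE('i) s R \<X> \<Y> \<longleftrightarrow> perfect_duality_pair TYPE('i) s R \<M> \<C>"
proof -
  have pair: "dual_pair s R \<X> \<Y> \<longleftrightarrow> duality_pair s R \<M> \<C>"
    unfolding \<X>_def \<Y>_def by (rule dual_pair_kind_class_iff[OF subM subC])
  have zero: "contains_zero_modules s R \<M>" if "duality_pair s R \<M> \<C>"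
    using that by (rule duality_pair_contains_zero_modules)
  show "product_closed_dual_pair TYPE('i) s R \<X> \<Y> \<longleftrightarrow>
      product_closed_duality_pair TYPE('i) s R \<M> \<C>"
    using pair kind_class_rclosed_iff[OF subM zero] unfolding \<X>_def
    by (auto simp: product_closed_dual_pair_def product_closed_duality_pair_def
        cx_product_closed_iff mod_product_closed_iff)
  show coproduct: "coproduct_closed_dual_pair TYPE('i) s R \<X> \<Y> \<longleftrightarrow>
      coproduct_closed_duality_pair TYPE('i) s R \<M> \<C>"
    using pair kind_class_rclosed_iff[OF subM zero] unfolding \<X>_def
    by (auto simp: coproduct_closed_dual_pair_def coproduct_closed_duality_pair_def
        cx_coproduct_closed_iff mod_coproduct_closed_iff)
  have "duality_pair s R \<M> \<C>" if "coproduct_closed_duality_pair TYPE('i) s R \<M> \<C>"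
    using that by (simp add: coproduct_closed_duality_pair_def)
  then show "perfect_dual_pair TYPE('i) s R \<X> \<Y> \<longleftrightarrow> perfect_duality_pair TYPE('i) s R \<M> \<C>"
    using coproduct kind_class_extension_closed_iff[OF subM zero]
      kind_class_regular_iff[OF R subM zero]
    unfolding perfect_dual_pair_def perfect_duality_pair_def \<X>_def by blast
qed

lemma kind_class_triple:
  "(\<forall>(\<X>, \<Y>) \<in>
      {(dw_class s R \<M>, dw_class s' R \<C>), (ex_class s R \<M>, ex_class s' R \<C>),
       (tilde_class s R \<M>, tilde_class s' R \<C>)}. P \<X> \<Y>) \<longleftrightarrow>
    (\<forall>\<kappa>. P (kind_class \<kappa> s R \<M>) (kind_class \<kappa> s' R \<C>))"
proof -
  have "(\<forall>\<kappa>. Q \<kappa>) \<longleftrightarrow> Q Degreewise \<and> Q DegreewiseExact \<and> Q Cyclewise" for Q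
    by (metis cx_kind.exhaust)
  then show ?thesis by (simp add: kind_class_simps)
qed

theorem theorem4p2p1:
  fixes R :: "('r, 'k) ring_scheme"
  assumes "ring R"
  shows
    "(\<forall>s (\<M> :: ('r, 'm) module set) (\<C> :: ('r, 'm \<Rightarrow> qz) module set).
        duality_pair s R \<M> \<C> \<longrightarrow>
        (\<forall>(\<X>, \<Y>) \<in>
           {(dw_class s R \<M>, dw_class (opposite s) R \<C>),
            (ex_class s R \<M>, ex_class (opposite s) R \<C>),
            (tilde_class s R \<M>, tilde_class (opposite s) R \<C>)}.
           dual_pair s R \<X> \<Y> \<and>
           (product_closed_duality_pair TYPE('i) s R \<M> \<C> \<longrightarrow>
              product_closed_dual_pair TYPE('i) s R \<X> \<Y>) \<and>
           (coproduct_closed_duality_pair TYPE('i) s R \<M> \<C> \<longrightarrow>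
              coproduct_closed_dual_pair TYPE('i) s R \<X> \<Y>) \<and>
           (perfect_duality_pair TYPE('i) s R \<M> \<C> \<longrightarrow>
              perfect_dual_pair TYPE('i) s R \<X> \<Y>)))
     \<and>
     (\<forall>(\<M> :: ('r, 'm) module set) (\<C> :: ('r, 'm \<Rightarrow> qz) module set).
        \<M> \<subseteq> Collect (is_module LeftSide R) \<and> \<C> \<subseteq> Collect (is_module RightSide R) \<longrightarrow>
        (\<forall>(\<X>, \<Y>) \<in>
           {(dw_class LeftSide R \<M>, dw_class RightSide R \<C>),
            (ex_class LeftSide R \<M>, ex_class RightSide R \<C>),
            (tilde_class LeftSide R \<M>, tilde_class RightSide R \<C>)}.
           (dual_pair LeftSide R \<X> \<Y> \<longrightarrow> duality_pair LeftSide R \<M> \<C>) \<and>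
           (product_closed_dual_pair TYPE('i) LeftSide R \<X> \<Y> \<longrightarrow>
              product_closed_duality_pair TYPE('i) LeftSide R \<M> \<C>) \<and>
           (coproduct_closed_dual_pair TYPE('i) LeftSide R \<X> \<Y> \<longrightarrow>
              coproduct_closed_duality_pair TYPE('i) LeftSide R \<M> \<C>) \<and>
           (perfect_dual_pair TYPE('i) LeftSide R \<X> \<Y> \<longrightarrow>
              perfect_duality_pair TYPE('i) LeftSide R \<M> \<C>)))"
  unfolding kind_class_triple
proof (intro conjI allI impI)
  fix s :: side and \<M> :: "('r, 'm) module set" and \<C> :: "('r, 'm \<Rightarrow> qz) module set" and \<kappa>
  let ?X = "kind_class \<kappa> s R \<M>" and ?Y = "kind_class \<kappa> (opposite s) R \<C>"
  assume pair: "duality_pair s R \<M> \<C>"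
  then have sub: "\<M> \<subseteq> Collect (is_module s R)" "\<C> \<subseteq> Collect (is_module (opposite s) R)"
    by (auto simp: duality_pair_def)
  show "dual_pair s R ?X ?Y" using pair dual_pair_kind_class_iff[OF sub] by blast
  show "product_closed_dual_pair TYPE('i) s R ?X ?Y"
    if "product_closed_duality_pair TYPE('i) s R \<M> \<C>"
    using that closed_pairs_kind_class_iff(1)[OF assms sub] by blast
  show "coproduct_closed_dual_pair TYPE('i) s R ?X ?Y"
    if "coproduct_closed_duality_pair TYPE('i) s R \<M> \<C>"
    using that closed_pairs_kind_class_iff(2)[OF assms sub] by blast
  show "perfect_dual_pair TYPE('i) s R ?X ?Y"
    if "perfect_duality_pair TYPE('i) s R \<M> \<C>"
    using that closed_pairs_kind_class_iff(3)[OF assms sub] by blast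
next
  fix \<M> :: "('r, 'm) module set" and \<C> :: "('r, 'm \<Rightarrow> qz) module set" and \<kappa>
  let ?X = "kind_class \<kappa> LeftSide R \<M>" and ?Y = "kind_class \<kappa> RightSide R \<C>"
  assume "\<M> \<subseteq> Collect (is_module LeftSide R) \<and> \<C> \<subseteq> Collect (is_module RightSide R)"
  then have sub: "\<M> \<subseteq> Collect (is_module LeftSide R)"
    "\<C> \<subseteq> Collect (is_module (opposite LeftSide) R)" by simp_all
  note pairs = closed_pairs_kind_class_iff[OF assms sub, unfolded opposite.simps]
  show "duality_pair LeftSide R \<M> \<C>" if "dual_pair LeftSide R ?X ?Y"
    using that dual_pair_kind_class_iff[OF sub] by simp
  show "product_closed_duality_pair TYPE('i) LeftSide R \<M> \<C>"
    if "product_closed_dual_pair TYPE('i) LeftSide R ?X ?Y"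
    using that pairs(1) by blast
  show "coproduct_closed_duality_pair TYPE('i) LeftSide R \<M> \<C>"
    if "coproduct_closed_dual_pair TYPE('i) LeftSide R ?X ?Y"
    using that pairs(2) by blast
  show "perfect_duality_pair TYPE('i) LeftSide R \<M> \<C>"
    if "perfect_dual_pair TYPE('i) LeftSide R ?X ?Y"
    using that pairs(3) by blast
qed

end
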